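(* $\#\mathrm{P}_{\{-1,0,1\}}=\#\mathrm{P}_{\mathbb{Z}}$ (equality of classes of functions $\{0,1\}^\star\to\mathbb{R}$).
   Context: Weighted counting problem: it is given by a polynomial $p:\mathbb{N}\to\mathbb{N}$ and a function $w:\{0,1\}^\star\times\{0,1\}^\star\to\mathbb{R}$ for which there is a function $v:\{0,1\}^\star\times\{0,1\}^\star\times\mathbb{N}\to\mathbb{Z}$ such that $v(x,u,b)$ is computable in time polynomial in $|x|$, $|u|$ and $b$, and $|w(x,u)-v(x,u,b)/2^b|\le 2^{-b}$ for all $x,u\in\{0,1\}^\star$, $b\in\mathbb{N}$. The problem is to compute, for $x\in\{0,1\}^\star$, the function $f(x)=\sum_{u\in\{0,1\}^{p(|x|)}} w(x,u)$. For $S\subseteq\mathbb{R}$, $\#\mathrm{P}_S$ is the class of all weighted counting problems (identified with the functions $f$ they define) where the range of $w$ is contained in $S$. *)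

theory Defs
  imports Complex_Main "HOL-Computational_Algebra.Polynomial"
begin

text \<open>
  Polynomial time is measured on deterministic multi-tape Turing machines with two-way infinite
  tapes. Tapes, states and tape symbols are numbered from 0. State 0 is initial, and a machine
  halts when it enters the state numbered \<open>states M\<close>, for which no transition is specified.
  Symbol 0 is the blank; symbols 1 and 2 stand for the bits 0 and 1.
\<close>

datatype direction = Left | Stay | Right

record tm =
  tapes :: nat
  states :: nat
  symbols :: nat
  transition :: "nat \<Rightarrow> nat list \<Rightarrow> nat \<times> (nat \<times> direction) list"

text \<open>
  The values of \<open>transition M\<close> that matter form a finite table, indexed by the nonhalting states
  and the lists of scanned symbols (one per tape); \<open>wf_tm\<close> constrains exactly these.
\<close>

definition wf_tm :: "tm \<Rightarrow> bool" where
  "wf_tm M \<longleftrightarrow> symbols M \<ge> 3 \<and>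
     (\<forall>q ss. q < states M \<longrightarrow> length ss = tapes M \<longrightarrow> set ss \<subseteq> {..<symbols M} \<longrightarrow>
        (case transition M q ss of (q', acts) \<Rightarrow>
           q' \<le> states M \<and> length acts = tapes M \<and> fst ` set acts \<subseteq> {..<symbols M}))"

text \<open>
  A tape is described relative to its head: cell 0 is the scanned cell, and a head movement
  shifts the contents the other way.
\<close>

type_synonym tape = "int \<Rightarrow> nat"

fun move_head :: "direction \<Rightarrow> tape \<Rightarrow> tape" where
  "move_head Left t = (\<lambda>i. t (i - 1))"
| "move_head Stay t = t"
| "move_head Right t = (\<lambda>i. t (i + 1))"

fun act :: "nat \<times> direction \<Rightarrow> tape \<Rightarrow> tape" where
  "act (a, d) t = move_head d (t(0 := a))"

fun tm_step :: "tm \<Rightarrow> nat \<times> tape list \<Rightarrow> nat \<times> tape list" where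
  "tm_step M (q, ts) =
     (if q < states M
      then (case transition M q (map (\<lambda>t. t 0) ts) of (q', acts) \<Rightarrow> (q', map2 act acts ts))
      else (q, ts))"

definition bit_symbol :: "bool \<Rightarrow> nat" where
  "bit_symbol c = (if c then 2 else 1)"

definition word_tape :: "bool list \<Rightarrow> tape" where
  "word_tape bs = (\<lambda>i. if 0 \<le> i \<and> i < int (length bs) then bit_symbol (bs ! nat i) else 0)"

text \<open>The input words are placed on the first tapes, one word per tape.\<close>

definition initial_config :: "tm \<Rightarrow> bool list list \<Rightarrow> nat \<times> tape list" where
  "initial_config M ws =
     (0, map (\<lambda>j. word_tape (if j < length ws then ws ! j else [])) [0..<tapes M])"

text \<open>The word read off a tape starts at the scanned cell and extends up to the first blank.\<close>

definition reads_word :: "tape \<Rightarrow> bool list \<Rightarrow> bool" where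
  "reads_word t bs \<longleftrightarrow>
     (\<forall>i<length bs. t (int i) = bit_symbol (bs ! i)) \<and> t (int (length bs)) = 0"

text \<open>The output tape is the one following the input tapes.\<close>

definition tm_computes_within :: "tm \<Rightarrow> bool list list \<Rightarrow> bool list \<Rightarrow> nat \<Rightarrow> bool" where
  "tm_computes_within M ws out n \<longleftrightarrow> length ws < tapes M \<and>
     (\<exists>s\<le>n. \<exists>ts. (tm_step M ^^ s) (initial_config M ws) = (states M, ts) \<and>
        reads_word (ts ! length ws) out)"

text \<open>Integers are written in binary: a sign bit, then the absolute value, low-order bit first.\<close>

fun binary_digits :: "nat \<Rightarrow> bool list" where
  "binary_digits n = (if n = 0 then [] else odd n # binary_digits (n div 2))"

declare binary_digits.simps [simp del]

definition int_word :: "int \<Rightarrow> bool list" where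
  "int_word z = (z < 0) # binary_digits (nat \<bar>z\<bar>)"

text \<open>Real coefficients admit integer-valued polynomials such as \<open>n (n - 1) / 2\<close>.\<close>

definition polynomial_fun :: "(nat \<Rightarrow> nat) \<Rightarrow> bool" where
  "polynomial_fun p \<longleftrightarrow> (\<exists>q :: real poly. \<forall>n. real (p n) = poly q (real n))"

text \<open>
  The running time is polynomial in the value of \<open>b\<close>, so \<open>b\<close> is given in unary. A bound that is
  polynomial in three natural numbers amounts to a bound that is polynomial in their sum.
\<close>

definition polytime_computable :: "(bool list \<Rightarrow> bool list \<Rightarrow> nat \<Rightarrow> int) \<Rightarrow> bool" where
  "polytime_computable v \<longleftrightarrow>
     (\<exists>M r. wf_tm M \<and> polynomial_fun r \<and>
        (\<forall>x u b. tm_computes_within M [x, u, replicate b True] (int_word (v x u b))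
                   (r (length x + length u + b))))"

definition weighted_counting_problem ::
    "(nat \<Rightarrow> nat) \<Rightarrow> (bool list \<Rightarrow> bool list \<Rightarrow> real) \<Rightarrow> bool" where
  "weighted_counting_problem p w \<longleftrightarrow> polynomial_fun p \<and>
     (\<exists>v. polytime_computable v \<and>
        (\<forall>x u b. \<bar>w x u - real_of_int (v x u b) / 2 ^ b\<bar> \<le> 1 / 2 ^ b))"

definition counting_fun ::
    "(nat \<Rightarrow> nat) \<Rightarrow> (bool list \<Rightarrow> bool list \<Rightarrow> real) \<Rightarrow> bool list \<Rightarrow> real" where
  "counting_fun p w x = (\<Sum>u | length u = p (length x). w x u)"

definition sharpP :: "real set \<Rightarrow> (bool list \<Rightarrow> real) set" where
  "sharpP S = {counting_fun p w | p w. weighted_counting_problem p w \<and> (\<forall>x u. w x u \<in> S)}"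

end

theory Submission
  imports Defs
begin

text \<open>
  An integer \<open>w(x,u)\<close> is determined by its approximation \<open>v = v(x,u,2)\<close>, since \<open>|4w - v| \<le> 1\<close>.
  Its absolute value is the number of \<open>y \<ge> 0\<close> with \<open>4y + 3 \<le> |v|\<close>, and it has the sign of \<open>v\<close>
  unless it is 0. As \<open>v\<close> has polynomially many digits, \<open>y\<close> can range over the words of a
  sufficiently large polynomial length, and \<open>w(x,u)\<close> becomes a sum over \<open>y\<close> of terms in \<open>{-1,0,1}\<close>.

  It remains to combine \<open>u\<close> and \<open>y\<close> into one word \<open>z\<close> whose parts a machine can recover without
  evaluating the polynomial \<open>p\<close>. A self-delimiting code is used for \<open>u\<close> (every bit
  is preceded by 0, and a 1 ends the code), followed by \<open>y\<close> of length
  \<open>(|x| + |u| + 2)^K\<close> for a constant \<open>K\<close>. Since \<open>|z|\<close> is then strictly increasing in \<open>|u|\<close>, the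
  words \<open>z\<close> of the length belonging to \<open>|u| = p(|x|)\<close> that pass the length test are exactly the
  codes of pairs with \<open>|u| = p(|x|)\<close>; all others contribute 0. The test is performed by \<open>K\<close>
  nested loops on \<open>K\<close> additional tapes.
\<close>

section \<open>Runs of a step function\<close>

definition reaches :: "('c \<Rightarrow> 'c) \<Rightarrow> nat \<Rightarrow> 'c \<Rightarrow> 'c \<Rightarrow> bool" where
  "reaches f n c d \<longleftrightarrow> (\<exists>k\<le>n. (f ^^ k) c = d)"

lemma reaches_refl: "reaches f n c c"
  unfolding reaches_def by (rule exI[of _ 0]) simp

lemma reaches_trans: "reaches f m c d \<Longrightarrow> reaches f n d e \<Longrightarrow> reaches f (m + n) c e"
  unfolding reaches_def
proof clarify
  fix j k assume "j \<le> m" "k \<le> n"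
  then show "\<exists>l\<le>m + n. (f ^^ l) c = (f ^^ k) ((f ^^ j) c)"
    by (intro exI[of _ "k + j"]) (simp add: funpow_add)
qed

lemma reaches_mono: "reaches f m c d \<Longrightarrow> m \<le> n \<Longrightarrow> reaches f n c d"
  unfolding reaches_def using le_trans by blast

lemma reaches_step:
  assumes "f c = d" "reaches f n d e" "n < m"
  shows "reaches f m c e"
proof -
  from assms(2) obtain k where "k \<le> n" "(f ^^ k) d = e" by (auto simp: reaches_def)
  with assms show ?thesis
    unfolding reaches_def by (intro exI[of _ "Suc k"]) (simp add: funpow_swap1)
qed

lemmas reaches_Suc = reaches_step[OF _ _ lessI]

lemma reaches_one: "f c = d \<Longrightarrow> 0 < m \<Longrightarrow> reaches f m c d"
  by (rule reaches_step[OF _ reaches_refl])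

section \<open>Turing machines with arbitrary state types\<close>

definition run_step :: "('s \<Rightarrow> nat list \<Rightarrow> 's \<times> (nat \<times> direction) list) \<Rightarrow> 's \<Rightarrow>
    's \<times> tape list \<Rightarrow> 's \<times> tape list" where
  "run_step \<delta> h c = (case c of (s, ts) \<Rightarrow>
     if s = h then c
     else (case \<delta> s (map (\<lambda>t. t 0) ts) of (s', acts) \<Rightarrow> (s', map2 act acts ts)))"

text \<open>Machines have numbered states, with 0 initial and \<open>states M\<close> halting,
  whereas rules are easier to write over a datatype. Renumbering a finite closed state set gives a
  machine that runs in lockstep, so time bounds carry over unchanged.\<close>

lemma ex_tm_of_finite_states:
  assumes fin: "finite Q" and start: "s0 \<in> Q" and halt: "h \<notin> Q" and "m \<ge> 3"
    and closed: "\<And>s ss. s \<in> Q \<Longrightarrow> fst (\<delta> s ss) \<in> insert h Q"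
    and acts: "\<And>s ss. s \<in> Q \<Longrightarrow> length ss = k \<Longrightarrow> set ss \<subseteq> {..<m} \<Longrightarrow>
      length (snd (\<delta> s ss)) = k \<and> fst ` set (snd (\<delta> s ss)) \<subseteq> {..<m}"
  obtains M where "wf_tm M" "tapes M = k"
    and "\<And>n ws ts. reaches (run_step \<delta> h) n (s0, snd (initial_config M ws)) (h, ts) \<Longrightarrow>
      \<exists>j\<le>n. (tm_step M ^^ j) (initial_config M ws) = (states M, ts)"
proof -
  obtain g where g: "bij_betw g Q {0..<card Q}"
    using ex_bij_betw_finite_nat[OF fin] by blast
  \<comment> \<open>An arbitrary numbering of \<open>Q\<close> is followed by a transposition, so
    that \<open>s0\<close> receives the initial number 0.\<close>
  define swap where "swap i = (if i = g s0 then 0 else if i = 0 then g s0 else i)" for i :: nat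
  have "card Q > 0" using fin start by (metis card_gt_0_iff empty_iff)
  moreover have "g s0 < card Q" using g start by (auto simp: bij_betw_def)
  ultimately have "bij_betw swap {0..<card Q} {0..<card Q}"
    by (intro bij_betw_byWitness[where f' = swap]) (auto simp: swap_def)
  with g have "bij_betw (swap \<circ> g) Q {0..<card Q}" by (rule bij_betw_trans)
  moreover have "(swap \<circ> g) s0 = 0" by (simp add: swap_def)
  ultimately obtain e where e: "bij_betw e Q {0..<card Q}" and e0: "e s0 = 0" by blast
  \<comment> \<open>The default \<open>card Q\<close> is the halting number of \<open>M\<close>. By
    closure, \<open>h\<close> is the only state outside \<open>Q\<close> that a run can
    enter.\<close>
  define enc where "enc s = (if s \<in> Q then e s else card Q)" for s
  define d where "d = inv_into Q e"
  have d: "d (e s) = s" if "s \<in> Q" for s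
    using e that by (auto simp: d_def bij_betw_def)
  have dQ: "d q \<in> Q" if "q < card Q" for q
    using e that by (auto simp: d_def bij_betw_def intro: inv_into_into)
  have enc_le: "enc s \<le> card Q" for s
    using bij_betwE[OF e] by (auto simp: enc_def intro: less_imp_le)
  have enc_less: "enc s < card Q \<longleftrightarrow> s \<in> Q" for s
    using bij_betwE[OF e] by (auto simp: enc_def)
  define M where "M = \<lparr>tapes = k, states = card Q, symbols = m,
    transition = (\<lambda>q ss. case \<delta> (d q) ss of (s', as) \<Rightarrow> (enc s', as))\<rparr>"
  have "wf_tm M"
    unfolding wf_tm_def
  proof (intro conjI allI impI)
    fix q ss assume "q < states M" "length ss = tapes M" "set ss \<subseteq> {..<symbols M}"
    then show "case transition M q ss of (q', as) \<Rightarrow>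
       q' \<le> states M \<and> length as = tapes M \<and> fst ` set as \<subseteq> {..<symbols M}"
      using acts[of "d q" ss] dQ[of q] enc_le by (simp add: M_def case_prod_beta)
  qed (simp add: M_def \<open>m \<ge> 3\<close>)
  have step: "tm_step M (enc s, ts) = (enc s', ts') \<and> s' \<in> insert h Q"
    if "run_step \<delta> h (s, ts) = (s', ts')" "s \<in> insert h Q" for s ts s' ts'
  proof (cases "s = h")
    case True
    then show ?thesis using that halt by (simp add: run_step_def M_def enc_def)
  next
    case False
    then have "s \<in> Q" using that by simp
    then have "d (enc s) = s" "enc s < card Q" by (simp_all add: enc_less) (simp add: enc_def d)
    then show ?thesis
      using that False closed[OF \<open>s \<in> Q\<close>, of "map (\<lambda>t. t 0) ts"]
      by (auto simp: run_step_def M_def split: prod.splits)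
  qed
  have run: "(tm_step M ^^ j) (enc s0, us) = (enc s', ts') \<and> s' \<in> insert h Q"
    if "(run_step \<delta> h ^^ j) (s0, us) = (s', ts')" for j us s' ts'
    using that
  proof (induction j arbitrary: s' ts')
    case (Suc j)
    then show ?case using step by (cases "(run_step \<delta> h ^^ j) (s0, us)") auto
  qed (use start in auto)
  show thesis
  proof (rule that[OF \<open>wf_tm M\<close>])
    show "tapes M = k" by (simp add: M_def)
    fix n ws ts assume "reaches (run_step \<delta> h) n (s0, snd (initial_config M ws)) (h, ts)"
    then obtain j where "j \<le> n" "(run_step \<delta> h ^^ j) (s0, snd (initial_config M ws)) = (h, ts)"
      by (auto simp: reaches_def)
    moreover have "enc s0 = 0" "enc h = states M" using start halt e0 by (simp_all add: enc_def M_def)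
    ultimately show "\<exists>j\<le>n. (tm_step M ^^ j) (initial_config M ws) = (states M, ts)"
      using run[of j "snd (initial_config M ws)" h ts] by (auto simp: initial_config_def)
  qed
qed

section \<open>Shifted words\<close>

text \<open>Tapes are stored relative to the head, so this is the tape \<open>t\<close> with its
  head at cell \<open>k\<close>. A head movement changes only \<open>k\<close>, while the contents
  keep absolute positions.\<close>

definition shift :: "int \<Rightarrow> tape \<Rightarrow> tape" where
  "shift k t = (\<lambda>i. t (i + k))"

lemma shift_apply_0 [simp]: "shift k t 0 = t k"
  by (simp add: shift_def)

lemma shift_0 [simp]: "shift 0 t = t"
  by (simp add: shift_def)

lemma shift_shift [simp]: "shift j (shift k t) = shift (j + k) t"
  by (auto simp: shift_def algebra_simps)

lemma move_head_conv_shift: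
  "move_head Left t = shift (- 1) t" "move_head Stay t = t" "move_head Right t = shift 1 t"
  by (auto simp: shift_def)

lemma act_scanned: "t 0 = a \<Longrightarrow> act (a, d) t = move_head d t"
  by auto

lemma bit_symbol_neq_0 [simp]: "bit_symbol c \<noteq> 0" "0 < bit_symbol c"
  by (simp_all add: bit_symbol_def)

lemma bit_symbol_eq_2 [simp]: "bit_symbol c = 2 \<longleftrightarrow> c" "bit_symbol c = Suc (Suc 0) \<longleftrightarrow> c"
  by (simp_all add: bit_symbol_def)

lemma word_tape_Nil [simp]: "word_tape [] = (\<lambda>_. 0)"
  by (auto simp: word_tape_def)

lemma shift_blank [simp]: "shift k (\<lambda>_. 0) = (\<lambda>_. 0)"
  by (simp add: shift_def)

lemma word_tape_negative [simp]: "i < 0 \<Longrightarrow> word_tape bs i = 0"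
  by (simp add: word_tape_def)

lemma word_tape_Cons: "word_tape (c # bs) i = (if i = 0 then bit_symbol c else word_tape bs (i - 1))"
  by (auto simp: word_tape_def nth_Cons' nat_diff_distrib')

lemma word_tape_eq_0_iff: "word_tape bs i = 0 \<longleftrightarrow> i < 0 \<or> i \<ge> int (length bs)"
  by (auto simp: word_tape_def)

lemma word_tape_nth: "i < length bs \<Longrightarrow> word_tape bs (int i) = bit_symbol (bs ! i)"
  by (simp add: word_tape_def)

lemma erase_first_symbol: "act (0, Right) (word_tape (c # bs)) = word_tape bs"
  by (rule ext) (auto simp: word_tape_Cons)

lemma prepend_symbol:
  "act (bit_symbol c, Left) (shift (- 1) (word_tape bs)) = shift (- 1) (word_tape (c # bs))"
  by (rule ext) (auto simp: shift_def word_tape_Cons)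

lemma finish_prepending: "act (0, Right) (shift (- 1) (word_tape bs)) = word_tape bs"
  by (rule ext) (auto simp: shift_def word_tape_def)

lemma append_symbol:
  "act (bit_symbol c, d) (shift (int (length bs)) (word_tape bs)) =
     move_head d (shift (int (length bs)) (word_tape (bs @ [c])))"
proof -
  have "(shift (int (length bs)) (word_tape bs))(0 := bit_symbol c) =
      shift (int (length bs)) (word_tape (bs @ [c]))"
    by (rule ext) (auto simp: shift_def word_tape_def nth_append)
  then show ?thesis by simp
qed

lemma map2_act_update:
  "length as = length ts \<Longrightarrow> map2 act (as[i := a]) ts = (map2 act as ts)[i := act a (ts ! i)]"
proof (induction as ts arbitrary: i rule: list_induct2)
  case (Cons a as t ts) then show ?case by (cases i) auto
qed simp

section \<open>The machine\<close>

text \<open>In \<open>Cmp s g\<close>, the flag \<open>s\<close> tells whether the output of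
  \<open>N\<close> is negative, and \<open>g\<close> is the verdict on the digits compared so far.
  \<open>Out\<close> and \<open>Pad\<close> carry \<open>s\<close> on to the sign bit of the result.
  The argument of \<open>Inc\<close>, \<open>Chk\<close> and \<open>Rew\<close> is the number of a
  loop.\<close>

datatype state =
    Scan | Copy | Parse | Take | Body | Inc nat | Chk nat | Rew nat
  | End1 | End2 | End3 | End4 | Sim nat | Sign | Cmp bool bool
  | Out bool | Pad bool | Zero | Halt

definition hold :: "nat \<Rightarrow> nat \<times> direction" where
  "hold a = (a, Stay)"

abbreviation "holds \<equiv> map hold"

lemma act_hold [simp]: "t 0 = a \<Longrightarrow> act (hold a) t = t"
  by (auto simp: hold_def)

lemma map2_act_holds [simp]:
  "map2 act (map (hold \<circ> (\<lambda>t. t 0)) ts) ts = ts"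
  by (induction ts) auto

text \<open>Halting of \<open>N\<close> is redirected to \<open>Sign\<close>, where its output is
  examined. This also covers an \<open>N\<close> whose initial state is already halting.\<close>

definition sim_state :: "tm \<Rightarrow> nat \<Rightarrow> state" where
  "sim_state N q = (if q < states N then Sim q else Sign)"

text \<open>
  The tapes are the three inputs \<open>x\<close>, \<open>z\<close>, \<open>1\<^sup>b\<close> and the output, then \<open>K\<close> mark tapes,
  then the tapes of the given machine \<open>N\<close>.
  \<open>Scan\<close> and \<open>Copy\<close> copy \<open>x\<close>, backwards, to the first tape of \<open>N\<close> and put \<open>11\<close>, the unary
  precision 2, on its third; \<open>Parse\<close> and \<open>Take\<close> erase the part of \<open>z\<close> that encodes \<open>u\<close> and write
  \<open>u\<close> from right to left on the second. Meanwhile each mark tape receives \<open>|x| + |u| + 2\<close> marks.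
  \<open>Body\<close>, \<open>Inc\<close>, \<open>Chk\<close> and \<open>Rew\<close> are \<open>K\<close> nested loops that move the head on the rest \<open>y\<close> of \<open>z\<close>
  by \<open>(|x| + |u| + 2)^K\<close> cells; \<open>End1\<close> and \<open>End2\<close> test whether this is just past \<open>y\<close>. \<open>End3\<close> and
  \<open>End4\<close> append the digits 11, so that the number \<open>y\<close> becomes \<open>4y + 3\<close>. After the simulation of
  \<open>N\<close>, \<open>Cmp\<close> compares this number with the output of \<open>N\<close>, low-order digits first.
  \<open>Out\<close> and \<open>Pad\<close> write \<open>2^b\<close> or its negative from right to left, so that the output needs no
  rewinding; \<open>Zero\<close> writes 0.
\<close>

fun rule :: "nat \<Rightarrow> tm \<Rightarrow> state \<Rightarrow> nat \<Rightarrow> nat \<Rightarrow> nat \<Rightarrow> nat \<Rightarrow> nat list \<Rightarrow> nat list \<Rightarrow>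
    state \<times> (nat \<times> direction) list \<times> (nat \<times> direction) list \<times> (nat \<times> direction) list" where
  "rule K N Scan a b c d ls ms =
     (if a \<noteq> 0 then (Scan, [(a, Right), hold b, hold c, hold d], holds ls, holds ms)
      else (Copy, [(a, Left), hold b, hold c, hold d], holds ls, (holds ms)[2 := (2, Left)]))"
| "rule K N Copy a b c d ls ms =
     (if a \<noteq> 0 then (Copy, [(a, Left), hold b, hold c, hold d], map (\<lambda>_. (1, Right)) ls,
        (holds ms)[0 := (a, Left)])
      else (Parse, [hold a, hold b, hold c, hold d], map (\<lambda>_. (1, Right)) ls,
        (holds ms)[0 := (0, Right), 2 := (2, Stay)]))"
| "rule K N Parse a b c d ls ms =
     (if b = 0 then (Zero, [hold a, hold b, hold c, hold d], holds ls, holds ms)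
      else if b = 2 then (Body, [hold a, (0, Right), hold c, hold d], map (\<lambda>_. (1, Stay)) ls,
        (holds ms)[1 := (0, Right)])
      else (Take, [hold a, (0, Right), hold c, hold d], holds ls, holds ms))"
| "rule K N Take a b c d ls ms =
     (if b = 0 then (Zero, [hold a, hold b, hold c, hold d], holds ls, holds ms)
      else (Parse, [hold a, (0, Right), hold c, hold d], map (\<lambda>_. (1, Right)) ls,
        (holds ms)[1 := (b, Left)]))"
| "rule K N Body a b c d ls ms = (Inc 0, [hold a, (b, Right), hold c, hold d], holds ls, holds ms)"
| "rule K N (Inc j) a b c d ls ms =
     (if j < K
      then (Chk j, [hold a, hold b, hold c, hold d], (holds ls)[j := (ls ! j, Left)], holds ms)
      else (End1, [hold a, hold b, hold c, hold d], holds ls, holds ms))"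
| "rule K N (Chk j) a b c d ls ms =
     (if ls ! j \<noteq> 0 then (Body, [hold a, hold b, hold c, hold d], holds ls, holds ms)
      else (Rew j, [hold a, hold b, hold c, hold d], (holds ls)[j := (ls ! j, Right)], holds ms))"
| "rule K N (Rew j) a b c d ls ms =
     (if ls ! j \<noteq> 0
      then (Rew j, [hold a, hold b, hold c, hold d], (holds ls)[j := (ls ! j, Right)], holds ms)
      else (Inc (if j < K then Suc j else K), [hold a, hold b, hold c, hold d],
        (holds ls)[j := (ls ! j, Left)], holds ms))"
| "rule K N End1 a b c d ls ms =
     (if b \<noteq> 0 then (Zero, [hold a, hold b, hold c, hold d], holds ls, holds ms)
      else (End2, [hold a, (b, Left), hold c, hold d], holds ls, holds ms))"
| "rule K N End2 a b c d ls ms =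
     (if b = 0 then (Zero, [hold a, hold b, hold c, hold d], holds ls, holds ms)
      else (End3, [hold a, (b, Right), hold c, hold d], holds ls, holds ms))"
| "rule K N End3 a b c d ls ms = (End4, [hold a, (2, Right), hold c, hold d], holds ls, holds ms)"
| "rule K N End4 a b c d ls ms =
     (sim_state N 0, [hold a, (2, Stay), hold c, hold d], holds ls, holds ms)"
| "rule K N (Sim q) a b c d ls ms =
     (sim_state N (fst (transition N q ms)), [hold a, hold b, hold c, hold d], holds ls,
        snd (transition N q ms))"
| "rule K N Sign a b c d ls ms =
     (Cmp (ms ! 3 = 2) True, [hold a, hold b, hold c, hold d], holds ls,
        (holds ms)[3 := (ms ! 3, Right)])"
| "rule K N (Cmp s g) a b c d ls ms =
     (if b = 0 \<and> ms ! 3 = 0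
      then (if g then Out s else Zero, [hold a, hold b, hold c, hold d], holds ls, holds ms)
      else (Cmp s (if (b = 2) = (ms ! 3 = 2) then g else ms ! 3 = 2),
        [hold a, (b, if b = 0 then Stay else Left), hold c, hold d], holds ls,
        (holds ms)[3 := (ms ! 3, if ms ! 3 = 0 then Stay else Right)]))"
| "rule K N (Out s) a b c d ls ms = (Pad s, [hold a, hold b, hold c, (2, Left)], holds ls, holds ms)"
| "rule K N (Pad s) a b c d ls ms =
     (if c \<noteq> 0 then (Pad s, [hold a, hold b, (c, Right), (1, Left)], holds ls, holds ms)
      else (Halt, [hold a, hold b, hold c, (bit_symbol s, Stay)], holds ls, holds ms))"
| "rule K N Zero a b c d ls ms = (Halt, [hold a, hold b, hold c, (1, Stay)], holds ls, holds ms)"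
| "rule K N Halt a b c d ls ms = (Halt, [hold a, hold b, hold c, hold d], holds ls, holds ms)"

definition table :: "nat \<Rightarrow> tm \<Rightarrow> state \<Rightarrow> nat list \<Rightarrow> state \<times> (nat \<times> direction) list" where
  "table K N s ss = (case rule K N s (ss ! 0) (ss ! 1) (ss ! 2) (ss ! 3)
       (take K (drop 4 ss)) (drop (4 + K) ss) of (s', as, bs, cs) \<Rightarrow> (s', as @ bs @ cs))"

text \<open>The type \<open>state\<close> is infinite because of its numeric arguments; a machine
  needs a finite set of states that the rules do not leave except to \<open>Halt\<close>.\<close>

definition live :: "nat \<Rightarrow> tm \<Rightarrow> state set" where
  "live K N = {Scan, Copy, Parse, Take, Body, End1, End2, End3, End4, Sign, Zero}
     \<union> Inc ` {..K} \<union> Chk ` {..<K} \<union> Rew ` {..<K} \<union> Sim ` {..<states N}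
     \<union> range (\<lambda>(s, g). Cmp s g) \<union> range Out \<union> range Pad"

lemma finite_live: "finite (live K N)"
  by (simp add: live_def)

lemma live_simps [simp]:
  "Scan \<in> live K N" "Copy \<in> live K N" "Parse \<in> live K N" "Take \<in> live K N"
  "Body \<in> live K N" "End1 \<in> live K N" "End2 \<in> live K N" "End3 \<in> live K N"
  "End4 \<in> live K N" "Sign \<in> live K N" "Zero \<in> live K N" "Cmp s g \<in> live K N"
  "Out s \<in> live K N" "Pad s \<in> live K N" "Halt \<notin> live K N"
  "Inc j \<in> live K N \<longleftrightarrow> j \<le> K" "Chk j \<in> live K N \<longleftrightarrow> j < K" "Rew j \<in> live K N \<longleftrightarrow> j < K"
  "Sim q \<in> live K N \<longleftrightarrow> q < states N" "sim_state N q \<in> live K N"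
  by (auto simp: live_def sim_state_def)

lemma table_closed:
  assumes "s \<in> live K N"
  shows "fst (table K N s ss) \<in> insert Halt (live K N)"
proof -
  have "fst (rule K N s a b c d ls ms) \<in> insert Halt (live K N)" for a b c d ls ms
    using assms by (cases s) auto
  then show ?thesis unfolding table_def case_prod_beta by simp
qed

definition fits :: "nat \<Rightarrow> nat \<Rightarrow> (nat \<times> direction) list \<Rightarrow> bool" where
  "fits m n as \<longleftrightarrow> length as = n \<and> (\<forall>x \<in> set as. fst x < m)"

lemma fits_update: "fits m n as \<Longrightarrow> (i < n \<Longrightarrow> fst a < m) \<Longrightarrow> fits m n (as[i := a])"
proof (cases "i < n")
  case True
  assume "fits m n as" "i < n \<Longrightarrow> fst a < m"
  with True show ?thesis
    using set_update_subset_insert[of as i a] by (auto simp: fits_def)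
qed (simp add: fits_def list_update_beyond)

lemma table_acts:
  assumes "wf_tm N" "s \<in> live K N" "length ss = 4 + K + tapes N" "set ss \<subseteq> {..<symbols N}"
  shows "length (snd (table K N s ss)) = 4 + K + tapes N
    \<and> fst ` set (snd (table K N s ss)) \<subseteq> {..<symbols N}"
proof -
  define ls ms where "ls = take K (drop 4 ss)" and "ms = drop (4 + K) ss"
  have len: "length ls = K" "length ms = tapes N"
    using assms by (simp_all add: ls_def ms_def)
  have set_ms: "set ms \<subseteq> {..<symbols N}" and set_ls: "set ls \<subseteq> {..<symbols N}"
    using assms(4) set_drop_subset set_take_subset unfolding ls_def ms_def by (metis order_trans)+
  have nth_ms: "ms ! i < symbols N" if "i < tapes N" for i
    using set_ms len that nth_mem by (metis lessThan_iff subsetD)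
  have nth_ls: "ls ! i < symbols N" if "i < K" for i
    using set_ls len that nth_mem by (metis lessThan_iff subsetD)
  have m: "3 \<le> symbols N" using assms(1) by (simp add: wf_tm_def)
  have nth: "ss ! i < symbols N" if "i < 4" for i
    using subsetD[OF assms(4) nth_mem[of i ss]] assms(3) that by simp
  have fits4: "fits m 4 [x, y, z, w] \<longleftrightarrow> fst x < m \<and> fst y < m \<and> fst z < m \<and> fst w < m" for m x y z w
    by (auto simp: fits_def)
  have sim: "fits (symbols N) (tapes N) (snd (transition N q ms))" if "q < states N" for q
  proof -
    have "fst ` set (snd (transition N q ms)) \<subseteq> {..<symbols N}"
      "length (snd (transition N q ms)) = tapes N"
      using assms(1) that len(2) set_ms unfolding wf_tm_def case_prod_beta by blast+
    then show ?thesis by (auto simp: fits_def)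
  qed
  have "fits (symbols N) K (holds ls)" "fits (symbols N) (tapes N) (holds ms)"
    "fits (symbols N) K (map (\<lambda>_. (Suc 0, e)) ls)" for e
    using set_ls set_ms len m by (auto simp: fits_def hold_def)
  note this [simp]
  have bits: "bit_symbol e < symbols N" for e using m by (simp add: bit_symbol_def)
  have "case rule K N s (ss ! 0) (ss ! 1) (ss ! 2) (ss ! 3) ls ms of (s', as, bs, cs) \<Rightarrow>
      fits (symbols N) 4 as \<and> fits (symbols N) K bs \<and> fits (symbols N) (tapes N) cs"
    using assms(2) nth[of 0] nth[of 1] nth[of 2] nth[of 3] m
    by (cases s) (auto simp: fits4 bits sim nth_ms nth_ls hold_def intro!: fits_update)
  then show ?thesis
    unfolding table_def ls_def[symmetric] ms_def[symmetric]
    by (auto simp: fits_def split: prod.splits)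
qed

definition step :: "nat \<Rightarrow> tm \<Rightarrow> state \<times> tape list \<Rightarrow> state \<times> tape list" where
  "step K N = run_step (table K N) Halt"

definition conf :: "state \<Rightarrow> tape \<Rightarrow> tape \<Rightarrow> tape \<Rightarrow> tape \<Rightarrow> tape list \<Rightarrow> tape list \<Rightarrow> state \<times> tape list" where
  "conf s t0 t1 t2 t3 ls ms = (s, [t0, t1, t2, t3] @ ls @ ms)"

lemma length_rule:
  assumes "rule K N s a b c d ls ms = (s', as, bs, cs)"
  shows "length as = 4" "length bs = length ls"
  using assms by (cases s; auto split: if_splits)+

text \<open>Used as a simplification rule, this executes one step symbolically on the four groups of
  tapes, so that each phase reduces to evaluating \<open>rule\<close>.\<close>

lemma step_conf:
  assumes "length ls = K" "s \<noteq> Halt"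
  shows "step K N (conf s t0 t1 t2 t3 ls ms) =
    (case rule K N s (t0 0) (t1 0) (t2 0) (t3 0) (map (\<lambda>t. t 0) ls) (map (\<lambda>t. t 0) ms) of
      (s', as, bs, cs) \<Rightarrow> conf s' (act (as ! 0) t0) (act (as ! 1) t1) (act (as ! 2) t2)
        (act (as ! 3) t3) (map2 act bs ls) (map2 act cs ms))"
proof -
  obtain s' as bs cs where r: "rule K N s (t0 0) (t1 0) (t2 0) (t3 0) (map (\<lambda>t. t 0) ls)
      (map (\<lambda>t. t 0) ms) = (s', as, bs, cs)"
    by (metis prod_cases4)
  from length_rule[OF r] obtain a b c d where "as = [a, b, c, d]" and "length bs = length ls"
    by (auto simp: length_Suc_conv eval_nat_numeral)
  with r assms show ?thesis
    by (simp add: step_def run_step_def table_def conf_def eval_nat_numeral)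
qed

section \<open>Phases of a run\<close>

declare act.simps [simp del] move_head.simps [simp del] move_head_conv_shift [simp]
declare step_conf [simp] act_scanned [simp] numeral_2_eq_2 [simp] numeral_3_eq_3 [simp]

lemma reaches_sim:
  assumes "(tm_step N ^^ k) (q, ms) = (states N, ms')" "length ls = K"
  shows "reaches (step K N) k (conf (sim_state N q) t0 t1 t2 t3 ls ms) (conf Sign t0 t1 t2 t3 ls ms')"
  using assms(1)
proof (induction k arbitrary: q ms)
  case 0
  then show ?case by (simp add: sim_state_def reaches_refl)
next
  case (Suc k)
  obtain q' ms1 where q': "tm_step N (q, ms) = (q', ms1)" by fastforce
  with Suc.prems have "(tm_step N ^^ k) (q', ms1) = (states N, ms')" by (simp add: funpow_swap1)
  note IH = Suc.IH[OF this]
  show ?case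
  proof (cases "q < states N")
    case False
    \<comment> \<open>Here \<open>N\<close> has halted and \<open>tm_step\<close> idles, so the
      remaining steps need no counterpart.\<close>
    then show ?thesis using q' IH by (auto intro: reaches_mono)
  next
    case True
    then have "step K N (conf (sim_state N q) t0 t1 t2 t3 ls ms) = conf (sim_state N q') t0 t1 t2 t3 ls ms1"
      using q' assms(2) by (simp add: sim_state_def split: prod.splits)
    then show ?thesis by (rule reaches_step[OF _ IH]) simp
  qed
qed

section \<open>Mark tapes, copying of the input and decoding of \<open>z\<close>\<close>

definition marks :: "nat \<Rightarrow> tape" where
  "marks k = shift (int k) (word_tape (replicate k False))"

text \<open>The two head positions serve different purposes: \<open>marks\<close> is ready for
  another mark to be appended, \<open>last_mark\<close> is a loop counter ready to count
  down.\<close>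

definition last_mark :: "nat \<Rightarrow> tape" where
  "last_mark k = shift (int k - 1) (word_tape (replicate k False))"

lemma act_marks:
  "act (Suc 0, Right) (marks k) = marks (Suc k)"
  "act (Suc 0, Stay) (marks k) = last_mark (Suc k)"
  using append_symbol[of False _ "replicate k False"]
  by (simp_all add: marks_def last_mark_def bit_symbol_def replicate_append_same)

text \<open>Induction on the number of cells still to be scanned. The last step writes the right one
  of the two digits of the unary precision; the left one follows when \<open>Copy\<close>
  ends.\<close>

lemma reaches_Scan:
  assumes "i \<le> length x" "length ls = K"
  shows "reaches (step K N) (length x - i + 1)
    (conf Scan (shift (int i) (word_tape x)) t1 t2 t3 ls (a # b # c # ms))
    (conf Copy (shift (int (length x) - 1) (word_tape x)) t1 t2 t3 ls (a # b # act (2, Left) c # ms))"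
  using assms(1)
proof (induction "length x - i" arbitrary: i)
  case 0
  then have "word_tape x (int i) = 0" "i = length x" by (auto simp: word_tape_eq_0_iff)
  then show ?case using assms(2) by (intro reaches_one) simp_all
next
  case (Suc k)
  then have "i < length x" by simp
  with Suc assms(2) show ?case
    by (intro reaches_step[OF _ Suc.hyps(1)[of "Suc i"]])
      (auto simp: word_tape_nth add.commute)
qed

text \<open>The invariant is that \<open>drop i x\<close> has been copied. Writing from right to
  left leaves the head of the copy on its first cell. Every step adds a mark, including the one that
  finds the blank, hence \<open>k + i + 1\<close>.\<close>

lemma reaches_Copy:
  assumes "i \<le> length x"
  shows "reaches (step K N) (i + 1)
    (conf Copy (shift (int i - 1) (word_tape x)) t1 t2 t3 (replicate K (marks k))
      (shift (- 1) (word_tape (drop i x)) # b # c # ms))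
    (conf Parse (shift (- 1) (word_tape x)) t1 t2 t3 (replicate K (marks (k + i + 1)))
      (word_tape x # b # act (2, Stay) c # ms))"
  using assms
proof (induction i arbitrary: k)
  case 0
  then show ?case
    by (intro reaches_one) (simp_all add: finish_prepending act_marks)
next
  case (Suc i)
  then have "drop i x = x ! i # drop (Suc i) x" by (simp add: Cons_nth_drop_Suc)
  then have "act (bit_symbol (x ! i), Left) (shift (- 1) (word_tape (drop (Suc i) x))) =
      shift (- 1) (word_tape (drop i x))" by (simp add: prepend_symbol)
  then show ?case
    using reaches_step[OF _ Suc.IH[of "Suc k"], where m = "Suc i + 1"] Suc.prems
    by (simp add: word_tape_nth act_marks)
qed

text \<open>The accumulator collects the decoded bits in reverse order, just as the machine writes
  them from right to left. The reversal is harmless, since the sum runs over all words of a given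
  length.\<close>

fun parse :: "bool list \<Rightarrow> bool list \<Rightarrow> (bool list \<times> bool list) option" where
  "parse u [] = None"
| "parse u (True # y) = Some (u, y)"
| "parse u [False] = None"
| "parse u (False # c # z) = parse (c # u) z"

lemma word_tape_Cons_0 [simp]: "word_tape (c # bs) 0 = bit_symbol c"
  by (simp add: word_tape_Cons)

lemma reaches_Parse_None:
  assumes "parse u z = None"
  shows "\<exists>t1' ls' ms'. length ls' = K \<and> reaches (step K N) (length z + 1)
    (conf Parse t0 (word_tape z) t2 t3 (replicate K (marks k)) (a # shift (- 1) (word_tape u) # ms))
    (conf Zero t0 t1' t2 t3 ls' ms')"
  using assms
proof (induction u z arbitrary: k rule: parse.induct)
  case (1 u)
  show ?case by (intro exI conjI, rule length_replicate, rule reaches_one) simp_all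
next
  case (3 u)
  show ?case
    by (intro exI conjI, rule length_replicate[of K "marks k"], rule reaches_step[OF _ reaches_one[of _ _ _ 1]])
      (simp add: erase_first_symbol)+
next
  case (4 u c z)
  then obtain t1' ls' ms' where *: "length ls' = K" "reaches (step K N) (length z + 1)
    (conf Parse t0 (word_tape z) t2 t3 (replicate K (marks (Suc k)))
      (a # shift (- 1) (word_tape (c # u)) # ms)) (conf Zero t0 t1' t2 t3 ls' ms')"
    by fastforce
  show ?case
    by (intro exI conjI, rule *(1), rule reaches_step[OF _ reaches_Suc[OF _ *(2)]])
      (simp add: erase_first_symbol prepend_symbol act_marks)+
qed simp

text \<open>Each decoded bit adds a mark, and the terminating 1 adds a last one on which the head
  stays. Starting from the \<open>|x| + 1\<close> marks left by \<open>Copy\<close>, this makes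
  \<open>|x| + |u| + 2\<close>.\<close>

lemma reaches_Parse_Some:
  assumes "parse u z = Some (u', y)"
  shows "reaches (step K N) (length z + 1)
    (conf Parse t0 (word_tape z) t2 t3 (replicate K (marks (k + length u)))
      (a # shift (- 1) (word_tape u) # ms))
    (conf Body t0 (word_tape y) t2 t3 (replicate K (last_mark (k + length u' + 1)))
      (a # word_tape u' # ms))"
  using assms
proof (induction u z rule: parse.induct)
  case (2 u y)
  then show ?case
    by (intro reaches_one) (auto simp: erase_first_symbol finish_prepending act_marks)
next
  case (4 u c z)
  then show ?case
    by (intro reaches_step[OF _ reaches_Suc[OF _ "4.IH"]])
      (auto simp: erase_first_symbol prepend_symbol act_marks)
qed simp_all

section \<open>Nested loops on the mark tapes\<close>

lemma reaches_rewind: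
  assumes "i \<le> L" "j < K" "length ls = K"
  shows "reaches (step K N) (L - i + 1)
    (conf (Rew j) t0 t1 t2 t3 (ls[j := shift (int i) (word_tape (replicate L False))]) ms)
    (conf (Inc (Suc j)) t0 t1 t2 t3 (ls[j := last_mark L]) ms)"
  using assms(1)
proof (induction "L - i" arbitrary: i)
  case 0
  then have "word_tape (replicate L False) (int i) = 0" "i = L" by (auto simp: word_tape_eq_0_iff)
  then show ?case using assms(2,3)
    by (intro reaches_one) (simp_all add: map2_act_update last_mark_def)
next
  case (Suc k)
  then have "i < L" by simp
  with Suc assms show ?case
    by (intro reaches_step[OF _ Suc.hyps(1)[of "Suc i"]])
      (auto simp: word_tape_nth add.commute map2_act_update)
qed

text \<open>The first \<open>j\<close> mark tapes serve as loop counters of \<open>j\<close> nested loops.\<close>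

lemma reaches_sweep:
  assumes "j \<le> K" "L \<ge> 1" "length ls = K" "\<And>i. i < j \<Longrightarrow> ls ! i = last_mark L"
  shows "reaches (step K N) ((L + 4) ^ (j + 1))
    (conf Body t0 (shift p Y) t2 t3 ls ms)
    (conf (Inc j) t0 (shift (p + int (L ^ j)) Y) t2 t3 ls ms)"
  using assms
proof (induction j arbitrary: p ls)
  case 0
  then have "reaches (step K N) 1 (conf Body t0 (shift p Y) t2 t3 ls ms)
    (conf (Inc 0) t0 (shift (p + int (L ^ 0)) Y) t2 t3 ls ms)"
    by (intro reaches_one) (simp_all add: add.commute)
  then show ?case by (rule reaches_mono) simp
next
  case (Suc j)
  let ?T = "(L + 4) ^ (j + 1)"
  let ?W = "word_tape (replicate L False)"
  note outer = Suc.IH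
  \<comment> \<open>With counter \<open>j\<close> at cell \<open>h\<close>, the \<open>j\<close>
    inner loops are run \<open>h + 1\<close> more times. Each round moves the head on
    \<open>Y\<close> by \<open>L ^ j\<close> and costs \<open>?T\<close> steps, plus two for
    \<open>Inc\<close> and \<open>Chk\<close>.\<close>
  have inner: "reaches (step K N) ((h + 1) * (?T + 2))
      (conf Body t0 (shift p Y) t2 t3 (ls[j := shift (int h) ?W]) ms)
      (conf (Rew j) t0 (shift (p + int ((h + 1) * L ^ j)) Y) t2 t3 (ls[j := shift 0 ?W]) ms)"
    if "h < L" for h p
    using that
  proof (induction h arbitrary: p)
    case 0
    have 1: "reaches (step K N) ?T (conf Body t0 (shift p Y) t2 t3 (ls[j := shift (int 0) ?W]) ms)
       (conf (Inc j) t0 (shift (p + int (L ^ j)) Y) t2 t3 (ls[j := shift (int 0) ?W]) ms)"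
      using Suc.prems by (intro Suc.IH) auto
    have 2: "reaches (step K N) 2
       (conf (Inc j) t0 (shift (p + int (L ^ j)) Y) t2 t3 (ls[j := shift (int 0) ?W]) ms)
       (conf (Rew j) t0 (shift (p + int (L ^ j)) Y) t2 t3 (ls[j := shift 0 ?W]) ms)"
      using Suc.prems
      by (intro reaches_step[OF _ reaches_one[of _ _ _ 1]]) (auto simp: map2_act_update)
    show ?case using reaches_trans[OF 1 2] by simp
  next
    case (Suc h)
    have 1: "reaches (step K N) ?T (conf Body t0 (shift p Y) t2 t3 (ls[j := shift (int (Suc h)) ?W]) ms)
       (conf (Inc j) t0 (shift (p + int (L ^ j)) Y) t2 t3 (ls[j := shift (int (Suc h)) ?W]) ms)"
      using \<open>length ls = K\<close> Suc.prems \<open>Suc j \<le> K\<close> \<open>L \<ge> 1\<close> \<open>\<And>i. i < Suc j \<Longrightarrow> ls ! i = last_mark L\<close>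
      by (intro outer) auto
    have 2: "reaches (step K N) 2
       (conf (Inc j) t0 (shift (p + int (L ^ j)) Y) t2 t3 (ls[j := shift (int (Suc h)) ?W]) ms)
       (conf Body t0 (shift (p + int (L ^ j)) Y) t2 t3 (ls[j := shift (int h) ?W]) ms)"
      using \<open>length ls = K\<close> \<open>Suc j \<le> K\<close> Suc.prems
      by (intro reaches_step[OF _ reaches_one[of _ _ _ 1]]) (auto simp: map2_act_update word_tape_nth)
    have "h < L" using Suc.prems by simp
    have eqs: "?T + 2 + (h + 1) * (?T + 2) = (Suc h + 1) * (?T + 2)"
      "p + int (L ^ j) + int ((h + 1) * L ^ j) = p + int ((Suc h + 1) * L ^ j)"
      by (simp_all del: power_Suc)
    from reaches_trans[OF reaches_trans[OF 1 2] Suc.IH(1)[OF \<open>h < L\<close>, of "p + int (L ^ j)"]]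
    show ?case unfolding eqs .
  qed
  have "j < K" using Suc.prems by simp
  have ls: "ls[j := last_mark L] = ls" using Suc.prems(4)[of j] by (metis lessI list_update_id)
  have "1 * (L + 4) \<le> (L + 4) ^ j * (L + 4)" by (intro mult_right_mono) simp_all
  then have "L + 4 \<le> ?T" by (simp add: mult.commute)
  moreover have "(L + 4) ^ (Suc j + 1) = L * ?T + 4 * ?T" by (simp add: distrib_right)
  \<comment> \<open>The base \<open>L + 4\<close> absorbs the overhead: the left side is
    \<open>L * ?T + 3 * L + 1\<close>, and \<open>3 * L + 1\<close> is below
    \<open>4 * ?T\<close>.\<close>
  ultimately have "L * (?T + 2) + (L - 0 + 1) \<le> (L + 4) ^ (Suc j + 1)"
    by (simp only: distrib_left)
  moreover have "reaches (step K N) (L * (?T + 2) + (L - 0 + 1))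
      (conf Body t0 (shift p Y) t2 t3 (ls[j := last_mark L]) ms)
      (conf (Inc (Suc j)) t0 (shift (p + int (L ^ Suc j)) Y) t2 t3 (ls[j := last_mark L]) ms)"
  proof (rule reaches_trans)
    show "reaches (step K N) (L * (?T + 2))
        (conf Body t0 (shift p Y) t2 t3 (ls[j := last_mark L]) ms)
        (conf (Rew j) t0 (shift (p + int (L ^ Suc j)) Y) t2 t3 (ls[j := shift (int 0) ?W]) ms)"
      using inner[of "L - 1" p] Suc.prems(2) by (simp add: last_mark_def of_nat_diff)
    show "reaches (step K N) (L - 0 + 1)
        (conf (Rew j) t0 (shift (p + int (L ^ Suc j)) Y) t2 t3 (ls[j := shift (int 0) ?W]) ms)
        (conf (Inc (Suc j)) t0 (shift (p + int (L ^ Suc j)) Y) t2 t3 (ls[j := last_mark L]) ms)"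
      using \<open>j < K\<close> \<open>length ls = K\<close> by (intro reaches_rewind) simp_all
  qed
  ultimately show ?case unfolding ls by (rule reaches_mono[rotated])
qed


section \<open>The length test after the loops\<close>

lemma reaches_End_match:
  assumes "length ls = K" "int (length y) = k" "y \<noteq> []"
  shows "reaches (step K N) 5 (conf (Inc K) t0 (shift k (word_tape y)) t2 t3 ls ms)
    (conf (sim_state N 0) t0 (shift (k + 1) (word_tape (y @ [True, True]))) t2 t3 ls ms)"
proof -
  have rd: "word_tape y k = 0" "word_tape y (k - 1) \<noteq> 0"
    using assms by (auto simp: word_tape_eq_0_iff)
  have wr: "act (Suc (Suc 0), Right) (shift k (word_tape y)) = shift (k + 1) (word_tape (y @ [True]))"
    "act (Suc (Suc 0), Stay) (shift (k + 1) (word_tape (y @ [True]))) =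
      shift (k + 1) (word_tape (y @ [True, True]))"
    using append_symbol[of True Right y] append_symbol[of True Stay "y @ [True]"] assms(2)
    by (simp_all add: bit_symbol_def add.commute)
  note S = reaches_Suc[where f = "step K N"] and R = reaches_refl[of "step K N" 0]
  let ?c = "\<lambda>s t. conf s t0 t t2 t3 ls ms"
  have "step K N (?c (Inc K) (shift k (word_tape y))) = ?c End1 (shift k (word_tape y))"
    "step K N (?c End1 (shift k (word_tape y))) = ?c End2 (shift (k - 1) (word_tape y))"
    "step K N (?c End2 (shift (k - 1) (word_tape y))) = ?c End3 (shift k (word_tape y))"
    "step K N (?c End3 (shift k (word_tape y))) = ?c End4 (shift (k + 1) (word_tape (y @ [True])))"
    "step K N (?c End4 (shift (k + 1) (word_tape (y @ [True])))) =
      ?c (sim_state N 0) (shift (k + 1) (word_tape (y @ [True, True])))"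
    using assms(1) rd wr by simp_all
  from S[OF this(1) S[OF this(2) S[OF this(3)
        S[OF this(4) S[OF this(5) R]]]]]
  show ?thesis by (rule reaches_mono) simp
qed

text \<open>The nonblank cells of \<open>y\<close> are an interval starting at 0. So for
  \<open>k > 0\<close> the head is just past \<open>y\<close> exactly if cell \<open>k\<close> is
  blank and cell \<open>k - 1\<close> is not, and two looks suffice.\<close>

lemma reaches_End_mismatch:
  assumes "length ls = K" "int (length y) \<noteq> k" "k > 0"
  shows "\<exists>t1'. reaches (step K N) 3 (conf (Inc K) t0 (shift k (word_tape y)) t2 t3 ls ms)
    (conf Zero t0 t1' t2 t3 ls ms)"
proof -
  note S = reaches_Suc[where f = "step K N"] and R = reaches_refl[of "step K N" 0]
  let ?c = "\<lambda>s t. conf s t0 t t2 t3 ls ms"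
  have 1: "step K N (?c (Inc K) (shift k (word_tape y))) = ?c End1 (shift k (word_tape y))"
    using assms by simp
  show ?thesis
  proof (cases "k < int (length y)")
    case True
    then have "word_tape y k \<noteq> 0" using assms by (auto simp: word_tape_eq_0_iff)
    then have "step K N (?c End1 (shift k (word_tape y))) = ?c Zero (shift k (word_tape y))"
      using assms(1) by simp
    from S[OF 1 S[OF this R]]
    have "reaches (step K N) 3 (?c (Inc K) (shift k (word_tape y))) (?c Zero (shift k (word_tape y)))"
      by (rule reaches_mono) simp
    then show ?thesis by blast
  next
    case False
    then have "word_tape y k = 0" "word_tape y (k - 1) = 0"
      using assms by (auto simp: word_tape_eq_0_iff)
    then have "step K N (?c End1 (shift k (word_tape y))) = ?c End2 (shift (k - 1) (word_tape y))"
      "step K N (?c End2 (shift (k - 1) (word_tape y))) = ?c Zero (shift (k - 1) (word_tape y))"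
      using assms(1) by simp_all
    from S[OF 1 S[OF this(1) S[OF this(2) R]]]
    have "reaches (step K N) 3 (?c (Inc K) (shift k (word_tape y)))
        (?c Zero (shift (k - 1) (word_tape y)))"
      by (rule reaches_mono) simp
    then show ?thesis by blast
  qed
qed

text \<open>Low-order digits come first, so every later position with different digits overrides the
  verdict \<open>g\<close>. A word that has run out supplies digits 0.\<close>

fun ge_digits :: "bool \<Rightarrow> bool list \<Rightarrow> bool list \<Rightarrow> bool" where
  "ge_digits g [] [] = g"
| "ge_digits g (a # as) [] = ge_digits (if a then False else g) as []"
| "ge_digits g [] (c # cs) = ge_digits (if c then True else g) [] cs"
| "ge_digits g (a # as) (c # cs) = ge_digits (if a = c then g else c) as cs"

lemma reads_word_Cons: "reads_word t (c # cs) \<longleftrightarrow> t 0 = bit_symbol c \<and> reads_word (shift 1 t) cs"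
  by (auto simp: reads_word_def All_less_Suc2 shift_def add.commute)

lemma reads_word_Nil: "reads_word t [] \<longleftrightarrow> t 0 = 0"
  by (simp add: reads_word_def)

text \<open>The word on the tape of \<open>z\<close> is read from its right end leftwards, hence
  \<open>rev (take i y)\<close>. Either word may end first, so the induction is on the total number
  of digits left.\<close>

lemma reaches_Cmp:
  assumes "length ls = K" "i \<le> length y" "reads_word m3 cs"
  shows "\<exists>t1' ms'. reaches (step K N) (i + length cs + 1)
    (conf (Cmp s g) t0 (shift (int i - 1) (word_tape y)) t2 t3 ls (m0 # m1 # m2 # m3 # ms))
    (conf (if ge_digits g (rev (take i y)) cs then Out s else Zero) t0 t1' t2 t3 ls ms')"
  using assms(2,3)
proof (induction "i + length cs" arbitrary: i g cs m3 rule: less_induct)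
  case less
  show ?case
  proof (cases "i = 0 \<and> cs = []")
    case True
    with less.prems(2) show ?thesis
      by (intro exI reaches_one) (use assms(1) in \<open>simp_all add: reads_word_Nil\<close>)
  next
    case False
    \<comment> \<open>The three kinds of comparison step get a common form: fewer digits remain and
      the final verdict is unchanged.\<close>
    obtain i' cs' g' m3' where less': "i' + length cs' < i + length cs"
      and prems: "i' \<le> length y" "reads_word m3' cs'"
      and ge: "ge_digits g (rev (take i y)) cs = ge_digits g' (rev (take i' y)) cs'"
      and step: "step K N (conf (Cmp s g) t0 (shift (int i - 1) (word_tape y)) t2 t3 ls
          (m0 # m1 # m2 # m3 # ms)) =
        conf (Cmp s g') t0 (shift (int i' - 1) (word_tape y)) t2 t3 ls (m0 # m1 # m2 # m3' # ms)"
    proof (cases i)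
      case 0
      with False obtain c cs' where cs: "cs = c # cs'" by (cases cs) auto
      have r: "m3 0 = bit_symbol c" "reads_word (shift 1 m3) cs'"
        using less.prems(2) by (simp_all add: cs reads_word_Cons)
      show thesis
        by (rule that[of 0 cs' "shift 1 m3" "if c then True else g"])
          (use 0 cs r assms(1) in simp_all)
    next
      case (Suc i')
      with less.prems have i': "i' < length y" by simp
      then have rev: "rev (take i y) = y ! i' # rev (take i' y)"
        by (simp add: Suc take_Suc_conv_app_nth)
      show thesis
      proof (cases cs)
        case Nil
        show thesis
          by (rule that[of i' "[]" m3 "if y ! i' then False else g"])
            (use Nil Suc i' rev less.prems(2) assms(1) in
              \<open>simp_all add: reads_word_Nil word_tape_nth del: rev_take\<close>)
      next
        case (Cons c cs')
        have r: "m3 0 = bit_symbol c" "reads_word (shift 1 m3) cs'"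
          using less.prems(2) by (simp_all add: Cons reads_word_Cons)
        show thesis
          by (rule that[of i' cs' "shift 1 m3" "if y ! i' = c then g else c"])
            (use Cons Suc i' rev r assms(1) in \<open>simp_all add: word_tape_nth\<close>)
      qed
    qed
    obtain t1' ms' where "reaches (step K N) (i' + length cs' + 1)
      (conf (Cmp s g') t0 (shift (int i' - 1) (word_tape y)) t2 t3 ls (m0 # m1 # m2 # m3' # ms))
      (conf (if ge_digits g' (rev (take i' y)) cs' then Out s else Zero) t0 t1' t2 t3 ls ms')"
      using less.hyps[OF less' prems] by blast
    moreover have "i' + length cs' + 1 < i + length cs + 1" using less' by simp
    ultimately show ?thesis unfolding ge by (blast intro: reaches_step[where f = "step K N", OF step])
  qed
qed

lemma reads_word_word_tape: "reads_word (word_tape bs) bs"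
  by (simp add: reads_word_def word_tape_nth word_tape_eq_0_iff)

section \<open>Writing the result\<close>

lemma reaches_Pad:
  assumes "length ls = K" "j \<le> b"
  shows "\<exists>t3'. reads_word t3' (s # replicate b False @ [True]) \<and> reaches (step K N) (b - j + 1)
    (conf (Pad s) t0 t1 (shift (int j) (word_tape (replicate b True)))
      (shift (- 1) (word_tape (replicate j False @ [True]))) ls ms)
    (conf Halt t0 t1 (shift (int b) (word_tape (replicate b True))) t3' ls ms)"
  using assms(2)
proof (induction "b - j" arbitrary: j)
  case 0
  then have j: "j = b" and w: "word_tape (replicate b True) (int j) = 0"
    by (auto simp: word_tape_eq_0_iff)
  have "act (bit_symbol s, Stay) (shift (- 1) (word_tape w)) = word_tape (s # w)" for w
    by (rule ext) (auto simp: act.simps move_head.simps shift_def word_tape_Cons)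
  then show ?case
    by (intro exI[of _ "word_tape (s # replicate b False @ [True])"] conjI[OF reads_word_word_tape] reaches_one)
      (use assms(1) j w in simp_all)
next
  case (Suc k)
  then have IH: "k = b - Suc j" "Suc j \<le> b" and "j < b" by simp_all
  from Suc.hyps(1)[OF IH] obtain t3' where t3': "reads_word t3' (s # replicate b False @ [True])"
    and *: "reaches (step K N) (b - Suc j + 1)
    (conf (Pad s) t0 t1 (shift (int (Suc j)) (word_tape (replicate b True)))
      (shift (- 1) (word_tape (replicate (Suc j) False @ [True]))) ls ms)
    (conf Halt t0 t1 (shift (int b) (word_tape (replicate b True))) t3' ls ms)"
    by blast
  have "act (Suc 0, Left) (shift (- 1) (word_tape (replicate j False @ [True]))) =
     shift (- 1) (word_tape (replicate (Suc j) False @ [True]))"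
    using prepend_symbol[of False] by (simp add: bit_symbol_def)
  then have "step K N (conf (Pad s) t0 t1 (shift (int j) (word_tape (replicate b True)))
      (shift (- 1) (word_tape (replicate j False @ [True]))) ls ms) =
    conf (Pad s) t0 t1 (shift (int (Suc j)) (word_tape (replicate b True)))
      (shift (- 1) (word_tape (replicate (Suc j) False @ [True]))) ls ms"
    using assms(1) \<open>j < b\<close> by (simp add: word_tape_nth add.commute)
  from reaches_step[OF this *, of "b - j + 1"] t3' \<open>j < b\<close> show ?case by auto
qed

lemma reaches_Out:
  assumes "length ls = K"
  shows "\<exists>t2' t3'. reads_word t3' (s # replicate b False @ [True]) \<and> reaches (step K N) (b + 2)
    (conf (Out s) t0 t1 (word_tape (replicate b True)) (\<lambda>_. 0) ls ms)
    (conf Halt t0 t1 t2' t3' ls ms)"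
proof -
  obtain t3' where t3': "reads_word t3' (s # replicate b False @ [True])"
    and *: "reaches (step K N) (b + 1)
      (conf (Pad s) t0 t1 (word_tape (replicate b True)) (shift (- 1) (word_tape [True])) ls ms)
      (conf Halt t0 t1 (shift (int b) (word_tape (replicate b True))) t3' ls ms)"
    using reaches_Pad[OF assms, of 0 b s N t0 t1 ms] by auto
  have "act (Suc (Suc 0), Left) (\<lambda>_. 0) = shift (- 1) (word_tape [True])"
    using prepend_symbol[of True "[]"] by (simp add: bit_symbol_def)
  then have "step K N (conf (Out s) t0 t1 (word_tape (replicate b True)) (\<lambda>_. 0) ls ms) =
      conf (Pad s) t0 t1 (word_tape (replicate b True)) (shift (- 1) (word_tape [True])) ls ms"
    using assms by simp
  from reaches_step[OF this *, of "b + 2"] t3' show ?thesis by auto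
qed

lemma reaches_Zero:
  assumes "length ls = K"
  shows "\<exists>t3'. reads_word t3' [False] \<and>
    reaches (step K N) 1 (conf Zero t0 t1 t2 (\<lambda>_. 0) ls ms) (conf Halt t0 t1 t2 t3' ls ms)"
proof -
  have "act (Suc 0, Stay) (\<lambda>_. 0) = word_tape [False]"
    by (rule ext) (auto simp: act.simps move_head.simps word_tape_Cons bit_symbol_def)
  then show ?thesis
    by (intro exI[of _ "word_tape [False]"] conjI[OF reads_word_word_tape] reaches_one)
      (use assms in simp_all)
qed


declare numeral_2_eq_2 [simp del] numeral_3_eq_3 [simp del]

section \<open>Length of the output\<close>

definition support :: "tape \<Rightarrow> int set" where
  "support t = {i. t i \<noteq> 0}"

lemma support_act:
  assumes "finite (support t)"
  shows "finite (support (act a t))" "card (support (act a t)) \<le> Suc (card (support t))"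
proof -
  obtain c d where a: "a = (c, d)" by fastforce
  obtain k where k: "move_head d = shift k"
    by (cases d) (auto simp: fun_eq_iff intro: that[of 0] that[of 1] that[of "- 1"])
  have sub: "support (act a t) \<subseteq> (\<lambda>i. i - k) ` insert 0 (support t)"
  proof
    fix i assume "i \<in> support (act a t)"
    then have "i + k \<in> insert 0 (support t)"
      by (auto simp: support_def a act.simps k shift_def split: if_splits)
    then show "i \<in> (\<lambda>i. i - k) ` insert 0 (support t)" by (intro image_eqI[of _ _ "i + k"]) auto
  qed
  with assms show "finite (support (act a t))" by (meson finite_imageI finite_insert finite_subset)
  have "card (support (act a t)) \<le> card ((\<lambda>i. i - k) ` insert 0 (support t))"
    using sub assms by (intro card_mono) auto
  also have "\<dots> \<le> card (insert 0 (support t))" using assms by (intro card_image_le) simp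
  also have "\<dots> \<le> Suc (card (support t))" using assms by (simp add: card_insert_if)
  finally show "card (support (act a t)) \<le> Suc (card (support t))" .
qed

lemma act_symbols:
  assumes "range t \<subseteq> {..<m}" "fst a < m"
  shows "range (act a t) \<subseteq> {..<m}"
  using assms by (cases a; cases "snd a") (auto simp: act.simps shift_def image_subset_iff)

text \<open>The output tape starts blank, and a step makes at most one more cell nonblank; with
  \<open>length_le_card_support\<close>, the output is no longer than the running time. Symbol
  ranges are part of the induction because \<open>wf_tm\<close> speaks only about valid scanned
  symbols.\<close>

lemma wf_tm_run:
  assumes "wf_tm M" "length ws < tapes M"
    and "(tm_step M ^^ s) (initial_config M ws) = (q, ts)"
  shows "length ts = tapes M" and "finite (support (ts ! length ws))"
    and "card (support (ts ! length ws)) \<le> s"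
proof -
  have m: "symbols M \<ge> 3" using assms(1) by (simp add: wf_tm_def)
  have "length ts = tapes M \<and> (\<forall>t \<in> set ts. range t \<subseteq> {..<symbols M}) \<and>
      finite (support (ts ! length ws)) \<and> card (support (ts ! length ws)) \<le> s"
    using assms(3)
  proof (induction s arbitrary: q ts)
    case 0
    have "bit_symbol c < symbols M" for c using m by (simp add: bit_symbol_def)
    then show ?case
      using 0 assms(2) m by (auto simp: initial_config_def support_def word_tape_def)
  next
    case (Suc s)
    obtain q1 ts1 where 1: "(tm_step M ^^ s) (initial_config M ws) = (q1, ts1)" by fastforce
    note IH = Suc.IH[OF 1]
    have st: "tm_step M (q1, ts1) = (q, ts)" using Suc.prems 1 by simp
    show ?case
    proof (cases "q1 < states M")
      case False
      then show ?thesis using st IH by auto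
    next
      case True
      define ss where "ss = map (\<lambda>t. t 0) ts1"
      obtain acts where acts: "transition M q1 ss = (q, acts)" and ts: "ts = map2 act acts ts1"
        using st True by (auto simp: ss_def split: prod.splits)
      have "length ss = tapes M" "set ss \<subseteq> {..<symbols M}" using IH by (auto simp: ss_def)
      then have len: "length acts = tapes M" and sym: "fst ` set acts \<subseteq> {..<symbols M}"
        using assms(1) True acts unfolding wf_tm_def by (metis (mono_tags, lifting) case_prod_conv)+
      have nth: "ts ! i = act (acts ! i) (ts1 ! i)" if "i < tapes M" for i
        using that len IH by (simp add: ts)
      have len_ts: "length ts = tapes M" using len IH by (simp add: ts)
      have "range t \<subseteq> {..<symbols M}" if "t \<in> set ts" for t
      proof -
        from that obtain i where i: "i < tapes M" "t = ts ! i" by (metis in_set_conv_nth len_ts)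
        have "range (ts1 ! i) \<subseteq> {..<symbols M}" using IH i(1) nth_mem[of i ts1] by simp
        moreover have "fst (acts ! i) < symbols M"
          using subsetD[OF sym imageI[OF nth_mem[of i acts]]] len i(1) by simp
        ultimately have "range (act (acts ! i) (ts1 ! i)) \<subseteq> {..<symbols M}" by (rule act_symbols)
        with i nth show ?thesis by simp
      qed
      with IH len_ts support_act[of "ts1 ! length ws"] nth[OF assms(2)] show ?thesis
        by (metis le_trans Suc_le_mono)
    qed
  qed
  then show "length ts = tapes M" and "finite (support (ts ! length ws))"
    and "card (support (ts ! length ws)) \<le> s" by simp_all
qed

lemma length_le_card_support:
  assumes "reads_word t bs" "finite (support t)"
  shows "length bs \<le> card (support t)"
proof -
  have "int ` {..<length bs} \<subseteq> support t"
    using assms(1) by (auto simp: reads_word_def support_def)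
  from card_mono[OF assms(2) this] show ?thesis by (simp add: card_image)
qed

section \<open>Binary numbers\<close>

fun val :: "bool list \<Rightarrow> nat" where
  "val [] = 0"
| "val (c # cs) = of_bool c + 2 * val cs"

lemma val_binary_digits [simp]: "val (binary_digits n) = n"
proof (induction n rule: less_induct)
  case (less n)
  show ?case
    using less[of "n div 2"] by (cases "n = 0") (auto simp: binary_digits.simps[of n] binary_digits.simps[of 0] elim!: oddE evenE)
qed

lemma val_less: "val cs < 2 ^ length cs"
  by (induction cs) auto

lemma val_inject: "length as = length cs \<Longrightarrow> val as = val cs \<Longrightarrow> as = cs"
proof (induction as cs rule: list_induct2)
  case (Cons a as c cs)
  have "a = c" using arg_cong[OF Cons.prems, of even] by (cases a; cases c) simp_all
  with Cons show ?case by simp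
qed simp

lemma card_bool_lists: "card {cs :: bool list. length cs = n} = 2 ^ n"
  using card_lists_length_eq[of "UNIV :: bool set" n] by simp

lemma bij_betw_val: "bij_betw val {cs. length cs = n} {..<2 ^ n}"
proof -
  have inj: "inj_on val {cs. length cs = n}" by (auto intro!: inj_onI val_inject)
  have "val ` {cs. length cs = n} = {..<2 ^ n}"
  proof (rule card_subset_eq)
    show "val ` {cs. length cs = n} \<subseteq> {..<2 ^ n}" using val_less by auto
    show "card (val ` {cs. length cs = n}) = card {..<2 ^ n :: nat}"
      using inj by (simp add: card_image card_bool_lists)
  qed simp
  with inj show ?thesis by (simp add: bij_betw_def)
qed

lemma ge_digits_iff: "ge_digits g as cs \<longleftrightarrow> (if val as = val cs then g else val as < val cs)"
proof (induction g as cs rule: ge_digits.induct)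
  case (2 g a as)
  then show ?case by (cases a; simp)
next
  case (3 g c cs)
  then show ?case by (cases c; simp)
next
  case (4 g a as c cs)
  then show ?case by (cases a; cases c; simp; presburger)
qed simp

lemma binary_digits_power_2: "binary_digits (2 ^ b) = replicate b False @ [True]"
proof (induction b)
  case (Suc b)
  then show ?case by (simp add: binary_digits.simps[of "2 * 2 ^ b"])
qed (simp add: binary_digits.simps)

lemma int_word_simps:
  "int_word 0 = [False]"
  "int_word (2 ^ b) = False # replicate b False @ [True]"
  "int_word (- (2 ^ b)) = True # replicate b False @ [True]"
  by (simp_all add: int_word_def binary_digits.simps[of 0] nat_power_eq binary_digits_power_2)

section \<open>The complete run\<close>

text \<open>The number denoted by \<open>y\<close> has its high-order digit first, because
  \<open>Cmp\<close> starts at the right end of the word; hence \<open>rev y\<close>.\<close>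

definition decide :: "nat \<Rightarrow> (bool list \<Rightarrow> bool list \<Rightarrow> int) \<Rightarrow> bool list \<Rightarrow> bool list \<Rightarrow> int" where
  "decide K v x z = (case parse [] z of None \<Rightarrow> 0 | Some (u, y) \<Rightarrow>
     if length y = (length x + length u + 2) ^ K \<and> 4 * val (rev y) + 3 \<le> nat \<bar>v x u\<bar>
     then sgn (v x u) else 0)"

lemma parse_length: "parse u z = Some (u', y) \<Longrightarrow> length u' + length y \<le> length u + length z"
  by (induction u z rule: parse.induct) auto

text \<open>Here \<open>n\<close> stands for \<open>|x| + |z| + b\<close>. The first term pays for
  the loops, where \<open>L + 4 \<le> n + 6\<close>; the two copies of \<open>(n + 2) ^ K\<close>
  pay for the simulation of \<open>N\<close> and for reading its output; the rest covers the linear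
  phases.\<close>

definition time_bound :: "nat \<Rightarrow> nat \<Rightarrow> nat" where
  "time_bound K n = (n + 6) ^ (K + 1) + 2 * (n + 2) ^ K + 6 * n + 30"

definition accepts_output :: "nat \<Rightarrow> tm \<Rightarrow> nat \<Rightarrow> state \<times> tape list \<Rightarrow> bool list \<Rightarrow> bool" where
  "accepts_output K N n c out \<longleftrightarrow> (\<exists>t0 t1 t2 t3 ls ms. reads_word t3 out \<and>
     reaches (step K N) n c (conf Halt t0 t1 t2 t3 ls ms))"

lemma accepts_trans:
  assumes "reaches (step K N) m c d" "accepts_output K N n d out"
  shows "accepts_output K N (m + n) c out"
  using assms reaches_trans unfolding accepts_output_def by meson

lemma accepts_mono: "accepts_output K N m c out \<Longrightarrow> m \<le> n \<Longrightarrow> accepts_output K N n c out"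
  using reaches_mono unfolding accepts_output_def by meson

lemma accepts_Zero:
  "length ls = K \<Longrightarrow> accepts_output K N 1 (conf Zero t0 t1 t2 (\<lambda>_. 0) ls ms) (int_word 0)"
  using reaches_Zero unfolding accepts_output_def int_word_simps by meson

lemma accepts_Out:
  "length ls = K \<Longrightarrow> accepts_output K N (b + 2)
     (conf (Out s) t0 t1 (word_tape (replicate b True)) (\<lambda>_. 0) ls ms)
     (int_word ((if s then - 1 else 1) * 2 ^ b))"
proof -
  assume "length ls = K"
  moreover have "int_word ((if s then - 1 else 1) * 2 ^ b) = s # replicate b False @ [True]"
    by (simp add: int_word_simps)
  ultimately show ?thesis using reaches_Out[of ls K s b N t0 t1 ms] unfolding accepts_output_def by metis
qed

lemma accepts_Sign:
  assumes "length ls = K" "reads_word m3 (int_word a)"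
  shows "accepts_output K N (length y + length (int_word a) + b + 6)
    (conf Sign t0 (shift (int (length y) + 1) (word_tape (y @ [True, True])))
      (word_tape (replicate b True)) (\<lambda>_. 0) ls (m0 # m1 # m2 # m3 # ms))
    (int_word (2 ^ b * (if 4 * val (rev y) + 3 \<le> nat \<bar>a\<bar> then sgn a else 0)))"
proof -
  let ?y = "y @ [True, True]"
  let ?cs = "binary_digits (nat \<bar>a\<bar>)"
  let ?g = "ge_digits True (rev (take (length y + 2) ?y)) ?cs"
  have m3: "m3 0 = bit_symbol (a < 0)" "reads_word (shift 1 m3) ?cs"
    using assms(2) by (simp_all add: int_word_def reads_word_Cons)
  have 1: "step K N (conf Sign t0 (shift (int (length y) + 1) (word_tape ?y))
      (word_tape (replicate b True)) (\<lambda>_. 0) ls (m0 # m1 # m2 # m3 # ms)) =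
    conf (Cmp (a < 0) True) t0 (shift (int (length y + 2) - 1) (word_tape ?y))
      (word_tape (replicate b True)) (\<lambda>_. 0) ls (m0 # m1 # m2 # shift 1 m3 # ms)"
    using assms(1) m3(1) by (simp add: add.commute)
  obtain t1' ms' where 2: "reaches (step K N) (length y + 2 + length ?cs + 1)
    (conf (Cmp (a < 0) True) t0 (shift (int (length y + 2) - 1) (word_tape ?y))
      (word_tape (replicate b True)) (\<lambda>_. 0) ls (m0 # m1 # m2 # shift 1 m3 # ms))
    (conf (if ?g then Out (a < 0) else Zero) t0 t1' (word_tape (replicate b True)) (\<lambda>_. 0) ls ms')"
    using reaches_Cmp[OF assms(1) _ m3(2), of "length y + 2" ?y N "a < 0" True t0
      "word_tape (replicate b True)" "\<lambda>_. 0" m0 m1 m2 ms] by auto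
  have g: "?g \<longleftrightarrow> 4 * val (rev y) + 3 \<le> nat \<bar>a\<bar>"
  proof -
    have "val (rev (take (length y + 2) ?y)) = 4 * val (rev y) + 3" by simp
    then show ?thesis unfolding ge_digits_iff by auto
  qed
  have 3: "accepts_output K N (b + 2)
    (conf (if ?g then Out (a < 0) else Zero) t0 t1' (word_tape (replicate b True)) (\<lambda>_. 0) ls ms')
    (int_word (2 ^ b * (if 4 * val (rev y) + 3 \<le> nat \<bar>a\<bar> then sgn a else 0)))"
  proof (cases ?g)
    case True
    \<comment> \<open>The inequality excludes \<open>a = 0\<close>, so the flag \<open>a < 0\<close>
      determines \<open>sgn a\<close>.\<close>
    then have *: "2 ^ b * (if 4 * val (rev y) + 3 \<le> nat \<bar>a\<bar> then sgn a else 0) =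
        (if a < 0 then - 1 else 1) * 2 ^ b" unfolding g by (auto simp: sgn_if)
    show ?thesis unfolding * if_P[OF True] by (rule accepts_Out[OF assms(1)])
  next
    case False
    then show ?thesis using accepts_mono[OF accepts_Zero[OF assms(1)]] g by simp
  qed
  have "reaches (step K N) (length y + length ?cs + 4)
    (conf Sign t0 (shift (int (length y) + 1) (word_tape ?y))
      (word_tape (replicate b True)) (\<lambda>_. 0) ls (m0 # m1 # m2 # m3 # ms))
    (conf (if ?g then Out (a < 0) else Zero) t0 t1' (word_tape (replicate b True)) (\<lambda>_. 0) ls ms')"
    by (rule reaches_step[where f = "step K N", OF 1 2]) simp
  from accepts_mono[OF accepts_trans[OF this 3]] show ?thesis by (simp add: int_word_def)
qed


lemma initial_config_triple:
  assumes "tapes M = Suc (Suc (Suc n))"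
  shows "initial_config M [x, y, z] =
    (0, word_tape x # word_tape y # word_tape z # replicate n (\<lambda>_. 0))"
proof -
  have "map (\<lambda>j. word_tape (if j < length [x, y, z] then [x, y, z] ! j else [])) [0..<tapes M] =
      word_tape x # word_tape y # word_tape z # replicate n (\<lambda>_. 0)"
  proof (rule nth_equalityI)
    fix i assume "i < length (map (\<lambda>j. word_tape (if j < length [x, y, z] then [x, y, z] ! j else []))
      [0..<tapes M])"
    then show "map (\<lambda>j. word_tape (if j < length [x, y, z] then [x, y, z] ! j else [])) [0..<tapes M] ! i =
      (word_tape x # word_tape y # word_tape z # replicate n (\<lambda>_. 0)) ! i"
      using assms by (auto simp: nth_Cons' less_Suc_eq simp del: upt_Suc)
  qed (use assms in simp)
  then show ?thesis unfolding initial_config_def by simp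
qed

text \<open>The phases are chained. A run ends in \<open>Zero\<close> after a failed decoding or a
  failed length test; otherwise \<open>|y| = L ^ K\<close>, which also bounds the running time of
  \<open>N\<close> on \<open>x\<close>, \<open>u\<close> and precision 2.\<close>

lemma accepts_Scan:
  assumes "wf_tm N" and tapes: "tapes N = Suc (Suc (Suc (Suc k)))"
    and comp: "\<And>x u. tm_computes_within N [x, u, [True, True]] (int_word (v x u)) (r (length x + length u + 2))"
    and r: "\<And>n. n \<ge> 2 \<Longrightarrow> r n \<le> n ^ K"
  shows "accepts_output K N (time_bound K (length x + length z + b))
    (conf Scan (word_tape x) (word_tape z) (word_tape (replicate b True)) (\<lambda>_. 0)
       (replicate K (\<lambda>_. 0)) (replicate (tapes N) (\<lambda>_. 0)))
    (int_word (2 ^ b * decide K v x z))"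
proof -
  let ?B = "word_tape (replicate b True)"
  let ?X = "word_tape x"
  let ?O = "\<lambda>_. 0 :: nat"
  let ?TT = "word_tape [True, True]"
  let ?S = "length x + length z + b"
  have marks0: "marks 0 = ?O" by (simp add: marks_def)
  have TT: "act (2, Stay) (act (2, Left) ?O) = ?TT"
    by (rule ext) (auto simp: act.simps shift_def word_tape_Cons bit_symbol_def)
  have scan: "reaches (step K N) (length x + 1)
    (conf Scan ?X (word_tape z) ?B ?O (replicate K ?O) (replicate (tapes N) ?O))
    (conf Copy (shift (int (length x) - 1) ?X) (word_tape z) ?B ?O (replicate K (marks 0))
      (?O # ?O # act (2, Left) ?O # replicate (Suc k) ?O))"
    using reaches_Scan[of 0 x "replicate K ?O" K N "word_tape z" ?B ?O ?O ?O ?O "replicate (Suc k) ?O"]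
    by (simp add: tapes marks0)
  have copy: "reaches (step K N) (length x + 1)
    (conf Copy (shift (int (length x) - 1) ?X) (word_tape z) ?B ?O (replicate K (marks 0))
      (?O # ?O # act (2, Left) ?O # replicate (Suc k) ?O))
    (conf Parse (shift (- 1) ?X) (word_tape z) ?B ?O (replicate K (marks (length x + 1)))
      (?X # shift (- 1) (word_tape []) # ?TT # replicate (Suc k) ?O))"
    using reaches_Copy[of "length x" x K N "word_tape z" ?B ?O 0 ?O "act (2, Left) ?O" "replicate (Suc k) ?O"]
    by (simp add: TT)
  note prefix = reaches_trans[OF scan copy]
  show ?thesis
  proof (cases "parse [] z")
    case None
    from reaches_Parse_None[OF None] obtain t1' ls' ms' where "length ls' = K" and
      parse: "reaches (step K N) (length z + 1)
        (conf Parse (shift (- 1) ?X) (word_tape z) ?B ?O (replicate K (marks (length x + 1)))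
          (?X # shift (- 1) (word_tape []) # ?TT # replicate (Suc k) ?O))
        (conf Zero (shift (- 1) ?X) t1' ?B ?O ls' ms')" by blast
    from accepts_trans[OF reaches_trans[OF prefix parse] accepts_Zero[OF this(1)]]
    have "accepts_output K N (length x + 1 + (length x + 1) + (length z + 1) + 1)
        (conf Scan ?X (word_tape z) ?B ?O (replicate K ?O) (replicate (tapes N) ?O))
        (int_word (2 ^ b * decide K v x z))" by (simp add: decide_def None)
    then show ?thesis by (rule accepts_mono) (simp add: time_bound_def)
  next
    case (Some uy)
    then obtain u y where uy: "parse [] z = Some (u, y)" by (cases uy) auto
    define L where "L = length x + length u + 2"
    have len: "length u + length y \<le> length z" using parse_length[OF uy] by simp
    then have "L \<le> ?S + 2" by (simp add: L_def)
    then have L_pow: "(L + 4) ^ (K + 1) \<le> (?S + 6) ^ (K + 1)" "L ^ K \<le> (?S + 2) ^ K"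
      by (intro power_mono; simp)+
    define ms where "ms = ?X # word_tape u # ?TT # replicate (Suc k) ?O"
    have parse: "reaches (step K N) (length z + 1)
        (conf Parse (shift (- 1) ?X) (word_tape z) ?B ?O (replicate K (marks (length x + 1)))
          (?X # shift (- 1) (word_tape []) # ?TT # replicate (Suc k) ?O))
        (conf Body (shift (- 1) ?X) (shift 0 (word_tape y)) ?B ?O (replicate K (last_mark L)) ms)"
      using reaches_Parse_Some[OF uy, of K N "shift (- 1) ?X" ?B ?O "length x + 1"]
      by (simp add: L_def ms_def)
    have sweep: "reaches (step K N) ((L + 4) ^ (K + 1))
        (conf Body (shift (- 1) ?X) (shift 0 (word_tape y)) ?B ?O (replicate K (last_mark L)) ms)
        (conf (Inc K) (shift (- 1) ?X) (shift (int (L ^ K)) (word_tape y)) ?B ?O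
          (replicate K (last_mark L)) ms)"
      using reaches_sweep[of K K L "replicate K (last_mark L)" N "shift (- 1) ?X" 0 "word_tape y" ?B ?O ms]
      by (simp add: L_def)
    note swept = reaches_trans[OF reaches_trans[OF prefix parse] sweep]
    show ?thesis
    proof (cases "length y = L ^ K")
      case False
      then have "int (length y) \<noteq> int (L ^ K)" by (simp only: of_nat_eq_iff not_False_eq_True)
      moreover have "int (L ^ K) > 0" by (simp add: L_def)
      ultimately have "int (length y) \<noteq> int (L ^ K)" "int (L ^ K) > 0" by blast+
      from reaches_End_mismatch[OF length_replicate this] obtain t1' where stop:
        "reaches (step K N) 3 (conf (Inc K) (shift (- 1) ?X) (shift (int (L ^ K)) (word_tape y)) ?B ?O
            (replicate K (last_mark L)) ms)
          (conf Zero (shift (- 1) ?X) t1' ?B ?O (replicate K (last_mark L)) ms)" by blast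
      have "decide K v x z = 0" using False by (simp add: decide_def uy L_def)
      with accepts_trans[OF reaches_trans[OF swept stop] accepts_Zero[OF length_replicate]]
      have "accepts_output K N
         (length x + 1 + (length x + 1) + (length z + 1) + (L + 4) ^ (K + 1) + 3 + 1)
         (conf Scan ?X (word_tape z) ?B ?O (replicate K ?O) (replicate (tapes N) ?O))
         (int_word (2 ^ b * decide K v x z))" by simp
      then show ?thesis
        by (rule accepts_mono) (use L_pow in \<open>simp add: time_bound_def\<close>)
    next
      case True
      have "y \<noteq> []" using True by (auto simp: L_def)
      have stop: "reaches (step K N) 5
          (conf (Inc K) (shift (- 1) ?X) (shift (int (L ^ K)) (word_tape y)) ?B ?O
            (replicate K (last_mark L)) ms)
          (conf (sim_state N 0) (shift (- 1) ?X) (shift (int (length y) + 1) (word_tape (y @ [True, True])))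
            ?B ?O (replicate K (last_mark L)) ms)"
        using reaches_End_match[of "replicate K (last_mark L)" K y "int (L ^ K)" N] True \<open>y \<noteq> []\<close> by simp
      obtain s ms' where s: "s \<le> r L"
        and run: "(tm_step N ^^ s) (initial_config N [x, u, [True, True]]) = (states N, ms')"
        and out: "reads_word (ms' ! 3) (int_word (v x u))"
        using comp[of x u] by (auto simp: tm_computes_within_def L_def eval_nat_numeral)
      have init: "initial_config N [x, u, [True, True]] = (0, ms)"
        using initial_config_triple[of N "Suc k"] tapes by (simp add: ms_def)
      have sim: "reaches (step K N) s
          (conf (sim_state N 0) (shift (- 1) ?X) (shift (int (length y) + 1) (word_tape (y @ [True, True])))
            ?B ?O (replicate K (last_mark L)) ms)
          (conf Sign (shift (- 1) ?X) (shift (int (length y) + 1) (word_tape (y @ [True, True])))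
            ?B ?O (replicate K (last_mark L)) ms')"
        using run unfolding init by (rule reaches_sim) simp
      have out_len: "length (int_word (v x u)) \<le> s" and "length ms' = tapes N"
        using wf_tm_run[OF \<open>wf_tm N\<close> _ run] length_le_card_support[of "ms' ! 3"] out tapes
        by (auto simp: eval_nat_numeral intro: le_trans)
      then obtain m0 m1 m2 m3 ms'' where ms': "ms' = m0 # m1 # m2 # m3 # ms''"
        using tapes by (auto simp: length_Suc_conv)
      have m3: "reads_word m3 (int_word (v x u))" using out by (simp add: ms')
      have sign: "accepts_output K N (length y + length (int_word (v x u)) + b + 6)
          (conf Sign (shift (- 1) ?X) (shift (int (length y) + 1) (word_tape (y @ [True, True])))
            ?B ?O (replicate K (last_mark L)) ms')
          (int_word (2 ^ b * decide K v x z))"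
        using accepts_Sign[OF length_replicate m3, where N = N and y = y and b = b] True
        by (simp add: ms' decide_def uy L_def)
      have "s \<le> (?S + 2) ^ K" using s r[of L] L_pow(2) by (simp add: L_def)
      show ?thesis
        by (rule accepts_mono[OF accepts_trans[OF reaches_trans[OF reaches_trans[OF swept stop] sim] sign]])
          (use L_pow out_len len \<open>s \<le> (?S + 2) ^ K\<close> in \<open>simp add: time_bound_def\<close>)
    qed
  qed
qed

lemma polynomial_fun_time_bound: "polynomial_fun (time_bound K)"
  unfolding polynomial_fun_def
  by (rule exI[of _ "[:6, 1:] ^ (K + 1) + 2 * [:2, 1:] ^ K + 6 * [:0, 1:] + 30"])
    (simp add: time_bound_def algebra_simps)

text \<open>The factor \<open>2 ^ b\<close> makes this an approximation function in the required
  format, and an exact one, since \<open>decide\<close> is integer-valued.\<close>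

lemma polytime_decide:
  assumes "wf_tm N" and "tapes N > 3"
    and "\<And>x u. tm_computes_within N [x, u, [True, True]] (int_word (v x u)) (r (length x + length u + 2))"
    and "\<And>n. n \<ge> 2 \<Longrightarrow> r n \<le> n ^ K"
  shows "polytime_computable (\<lambda>x z b. 2 ^ b * decide K v x z)"
proof -
  obtain k where k: "tapes N = Suc (Suc (Suc (Suc k)))"
    using assms(2) by (metis Suc_diff_Suc numeral_3_eq_3 less_imp_Suc_add add_Suc)
  have "symbols N \<ge> 3" using assms(1) by (simp add: wf_tm_def)
  obtain M where "wf_tm M" and tapes_M: "tapes M = 4 + K + tapes N"
    and sim: "\<And>n ws ts. reaches (run_step (table K N) Halt) n (Scan, snd (initial_config M ws)) (Halt, ts)
      \<Longrightarrow> \<exists>j\<le>n. (tm_step M ^^ j) (initial_config M ws) = (states M, ts)"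
    by (rule ex_tm_of_finite_states[where Q = "live K N" and \<delta> = "table K N" and h = Halt
          and m = "symbols N" and k = "4 + K + tapes N" and ?s0.0 = Scan])
      (use finite_live table_closed table_acts[OF assms(1)] \<open>symbols N \<ge> 3\<close> in \<open>auto simp: image_subset_iff\<close>)
  have "tm_computes_within M [x, z, replicate b True] (int_word (2 ^ b * decide K v x z))
      (time_bound K (length x + length z + b))" for x z b
  proof -
    have init: "(Scan, snd (initial_config M [x, z, replicate b True])) =
        conf Scan (word_tape x) (word_tape z) (word_tape (replicate b True)) (\<lambda>_. 0)
          (replicate K (\<lambda>_. 0)) (replicate (tapes N) (\<lambda>_. 0))"
      using initial_config_triple[of M "1 + K + tapes N" x z "replicate b True"] tapes_M
      by (simp add: conf_def replicate_add)
    obtain t0 t1 t2 t3 ls ms where t3: "reads_word t3 (int_word (2 ^ b * decide K v x z))"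
      and run: "reaches (run_step (table K N) Halt) (time_bound K (length x + length z + b))
        (Scan, snd (initial_config M [x, z, replicate b True])) (conf Halt t0 t1 t2 t3 ls ms)"
      using accepts_Scan[OF assms(1) k assms(3,4), where x = x and z = z and b = b] unfolding init accepts_output_def step_def
      by blast
    from sim[OF run[unfolded conf_def]] t3 show ?thesis
      using tapes_M by (fastforce simp: tm_computes_within_def)
  qed
  with \<open>wf_tm M\<close> polynomial_fun_time_bound show ?thesis
    unfolding polytime_computable_def by blast
qed

section \<open>Counting\<close>

fun encode :: "bool list \<Rightarrow> bool list \<Rightarrow> bool list" where
  "encode [] y = True # y"
| "encode (c # u) y = False # c # encode u y"

lemma length_encode: "length (encode u y) = 2 * length u + 1 + length y"
  by (induction u) auto

lemma parse_encode: "parse a (encode u y) = Some (rev u @ a, y)"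
  by (induction u arbitrary: a) auto

lemma parse_Some_imp_encode:
  "parse a z = Some (u, y) \<Longrightarrow> \<exists>u'. u = rev u' @ a \<and> z = encode u' y"
proof (induction a z rule: parse.induct)
  case (2 a y')
  then show ?case by (intro exI[of _ "[]"]) auto
next
  case (4 a c z)
  then obtain u' where "u = rev u' @ c # a" "z = encode u' y" by auto
  then show ?case by (intro exI[of _ "c # u'"]) auto
qed auto

text \<open>The first two assumptions say that \<open>n\<close> differs from \<open>4 * k\<close> by
  at most 1. So \<open>4 * m + 3 \<le> n\<close> holds for \<open>m \<le> k - 1\<close>, where the
  left side is at most \<open>4 * k - 1\<close>, and fails for \<open>m \<ge> k\<close>. The third
  ensures that all \<open>m < k\<close> are values of words of length \<open>q\<close>.\<close>

lemma card_below:
  assumes "4 * k \<le> n + 1" "n \<le> 4 * k + 1" "k \<le> 2 ^ q"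
  shows "card {y. length y = q \<and> 4 * val (rev y) + 3 \<le> n} = k"
proof -
  have "bij_betw (val \<circ> rev) {y. length y = q} {..<2 ^ q}"
  proof (rule bij_betw_trans[OF _ bij_betw_val])
    show "bij_betw rev {y :: bool list. length y = q} {y. length y = q}"
      by (rule bij_betw_byWitness[of _ rev]) auto
  qed
  then have "bij_betw (val \<circ> rev) {y. length y = q \<and> 4 * val (rev y) + 3 \<le> n} {..<k}"
  proof (rule bij_betw_subset)
    have "(val \<circ> rev) ` {y. length y = q} = {..<2 ^ q}"
      using \<open>bij_betw (val \<circ> rev) {y. length y = q} {..<2 ^ q}\<close> by (simp add: bij_betw_def)
    then have "m \<in> (val \<circ> rev) ` {y. length y = q}" if "m < k" for m
      using that assms(3) by auto
    then show "(val \<circ> rev) ` {y. length y = q \<and> 4 * val (rev y) + 3 \<le> n} = {..<k}"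
      using assms(1,2) by (fastforce simp: image_iff)
  qed auto
  then show ?thesis using bij_betw_same_card by fastforce
qed

lemma finite_bool_lists: "finite {z :: bool list. length z = n}"
  using finite_lists_length_eq[of "UNIV :: bool set" n] by simp

text \<open>Only codes of pairs with \<open>|u| = p\<close> contribute, so the sum splits into one
  over \<open>u\<close> and one over \<open>y\<close>; the inner sum counts \<open>|w u|\<close>
  terms equal to the sign. By \<open>big\<close> there are enough words \<open>y\<close>.\<close>

lemma sum_decide:
  fixes p :: nat and w :: "bool list \<Rightarrow> int"
  assumes v: "\<And>u. length u = p \<Longrightarrow> \<bar>4 * w u - v x u\<bar> \<le> 1"
    and big: "\<And>u. length u = p \<Longrightarrow> \<bar>w u\<bar> \<le> 2 ^ (length x + p + 2) ^ K"
  shows "(\<Sum>z | length z = 2 * p + 1 + (length x + p + 2) ^ K. decide K v x z) = (\<Sum>u | length u = p. w u)"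
proof -
  define q where "q = (length x + p + 2) ^ K"
  let ?U = "{u :: bool list. length u = p}" and ?Y = "{y :: bool list. length y = q}"
  \<comment> \<open>The \<open>rev\<close> cancels the reversal done by \<open>parse\<close>, so
    that decoding returns \<open>u\<close> itself.\<close>
  let ?enc = "\<lambda>(u, y). encode (rev u) y"
  have decide_0: "decide K v x z = 0" if z: "length z = 2 * p + 1 + q" "z \<notin> ?enc ` (?U \<times> ?Y)" for z
  proof (rule ccontr)
    assume "decide K v x z \<noteq> 0"
    then obtain u y where uy: "parse [] z = Some (u, y)" and len: "length y = (length x + length u + 2) ^ K"
      by (auto simp: decide_def split: option.splits if_splits)
    from parse_Some_imp_encode[OF uy] have enc: "z = encode (rev u) y" by auto
    then have eq: "2 * length u + (length x + length u + 2) ^ K = 2 * p + (length x + p + 2) ^ K"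
      using z(1) len by (simp add: length_encode q_def)
    \<comment> \<open>Both sides of \<open>eq\<close> are values of one function of the length. Its
      linear term makes it strictly increasing, even if the power is constant.\<close>
    have "length u = p"
    proof (rule ccontr)
      assume "length u \<noteq> p"
      then consider "length u < p" | "p < length u" by linarith
      then show False
      proof cases
        case 1
        then have "(length x + length u + 2) ^ K \<le> (length x + p + 2) ^ K" by (intro power_mono) auto
        with 1 eq show False by linarith
      next
        case 2
        then have "(length x + p + 2) ^ K \<le> (length x + length u + 2) ^ K" by (intro power_mono) auto
        with 2 eq show False by linarith
      qed
    qed
    then have "z \<in> ?enc ` (?U \<times> ?Y)" using enc len by (intro image_eqI[of _ _ "(u, y)"]) (auto simp: q_def)
    with z(2) show False by simp
  qed
  have inj: "inj_on ?enc (?U \<times> ?Y)"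
  proof (rule inj_onI, clarify)
    fix u y u' y' assume "encode (rev u) y = encode (rev u') y'"
    then show "u = u' \<and> y = y'"
      by (metis append_Nil2 option.inject parse_encode prod.inject rev_rev_ident)
  qed
  have inner: "(\<Sum>y\<in>?Y. decide K v x (encode (rev u) y)) = w u" if "u \<in> ?U" for u
  proof -
    from that have u: "length u = p" by simp
    let ?n = "nat \<bar>v x u\<bar>"
    have "(\<Sum>y\<in>?Y. decide K v x (encode (rev u) y)) =
        (\<Sum>y\<in>?Y. if 4 * val (rev y) + 3 \<le> ?n then sgn (v x u) else 0)"
      by (rule sum.cong) (auto simp: decide_def parse_encode u q_def)
    also have "\<dots> = (\<Sum>y\<in>{y. length y = q \<and> 4 * val (rev y) + 3 \<le> ?n}. sgn (v x u))"
      using finite_bool_lists[of q] by (simp add: sum.inter_filter[symmetric])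
    also have "\<dots> = int (card {y. length y = q \<and> 4 * val (rev y) + 3 \<le> ?n}) * sgn (v x u)"
      by simp
    also have "card {y. length y = q \<and> 4 * val (rev y) + 3 \<le> ?n} = nat \<bar>w u\<bar>"
    proof (rule card_below)
      show "4 * nat \<bar>w u\<bar> \<le> ?n + 1" "?n \<le> 4 * nat \<bar>w u\<bar> + 1" using v[OF u] by linarith+
      have "int (nat \<bar>w u\<bar>) \<le> int (2 ^ q)" using big[OF u] by (simp add: q_def)
      then show "nat \<bar>w u\<bar> \<le> 2 ^ q" by (simp only: of_nat_le_iff)
    qed
    \<comment> \<open>If \<open>w u\<close> is not 0, then \<open>4 * w u\<close> is at least 4 in
      absolute value, so \<open>v x u\<close> has the same sign.\<close>
    also have "int (nat \<bar>w u\<bar>) * sgn (v x u) = w u"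
      using v[OF u] by (auto simp: sgn_if abs_if split: if_splits)
    finally show ?thesis .
  qed
  have "(\<Sum>z | length z = 2 * p + 1 + q. decide K v x z) = (\<Sum>z\<in>?enc ` (?U \<times> ?Y). decide K v x z)"
    by (rule sum.mono_neutral_right) (auto simp: finite_bool_lists length_encode decide_0)
  also have "\<dots> = (\<Sum>(u, y)\<in>?U \<times> ?Y. decide K v x (encode (rev u) y))"
    by (subst sum.reindex[OF inj]) (simp add: case_prod_beta comp_def)
  also have "\<dots> = (\<Sum>u\<in>?U. \<Sum>y\<in>?Y. decide K v x (encode (rev u) y))"
    by (simp add: sum.cartesian_product)
  also have "\<dots> = (\<Sum>u\<in>?U. w u)" by (rule sum.cong) (simp_all add: inner)
  finally show ?thesis by (simp add: q_def)
qed

section \<open>Polynomial bounds and the inclusion of the classes\<close>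

lemma polynomial_le_power:
  fixes q :: "real poly"
  obtains K where "\<And>n :: nat. n \<ge> 2 \<Longrightarrow> poly q (real n) \<le> real n ^ K"
proof -
  have "\<exists>K. \<forall>n :: nat. n \<ge> 2 \<longrightarrow> \<bar>poly q (real n)\<bar> \<le> real n ^ K"
  proof (induction q)
    case 0
    then show ?case by (intro exI[of _ 0]) simp
  next
    case (pCons a q)
    then obtain K where K: "\<And>n :: nat. n \<ge> 2 \<Longrightarrow> \<bar>poly q (real n)\<bar> \<le> real n ^ K" by blast
    \<comment> \<open>Since \<open>n \<ge> 2\<close>, the constant coefficient is absorbed by a
      power of \<open>n\<close>.\<close>
    obtain c :: nat where "\<bar>a\<bar> < 2 ^ c" using real_arch_pow[of 2 "\<bar>a\<bar>"] by auto
    \<comment> \<open>Beyond \<open>K + c\<close>, one power of \<open>n\<close> comes from the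
      multiplication by \<open>n\<close> in \<open>pCons\<close>, the other from bounding the factor
      2 of a sum of two terms.\<close>
    have "\<bar>poly (pCons a q) (real n)\<bar> \<le> real n ^ (K + c + 2)" if n: "n \<ge> 2" for n :: nat
    proof -
      have "\<bar>poly (pCons a q) (real n)\<bar> \<le> \<bar>a\<bar> + real n * \<bar>poly q (real n)\<bar>"
        using abs_triangle_ineq[of a "real n * poly q (real n)"] by (simp add: abs_mult)
      also have "\<dots> \<le> real n ^ c + real n * real n ^ K"
      proof (rule add_mono)
        have "(2 :: real) ^ c \<le> real n ^ c" using n by (intro power_mono) auto
        with \<open>\<bar>a\<bar> < 2 ^ c\<close> show "\<bar>a\<bar> \<le> real n ^ c" by simp
        show "real n * \<bar>poly q (real n)\<bar> \<le> real n * real n ^ K"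
          using K[OF n] by (intro mult_left_mono) auto
      qed
      also have "\<dots> \<le> real n ^ (K + c + 1) + real n ^ (K + c + 1)"
        using n by (intro add_mono) (auto intro!: power_increasing simp flip: power_Suc)
      also have "\<dots> = 2 * real n ^ (K + c + 1)" by simp
      also have "\<dots> \<le> real n * real n ^ (K + c + 1)" using n by (intro mult_right_mono) auto
      finally show ?thesis by simp
    qed
    then show ?case by blast
  qed
  then obtain K where "\<And>n :: nat. n \<ge> 2 \<Longrightarrow> \<bar>poly q (real n)\<bar> \<le> real n ^ K" by blast
  then show thesis by (intro that[of K]) (meson abs_ge_self order_trans)
qed

lemma int_word_bound:
  assumes "length (int_word a) \<le> n"
  shows "\<bar>a\<bar> < 2 ^ n"
proof -
  have "nat \<bar>a\<bar> < 2 ^ length (binary_digits (nat \<bar>a\<bar>))"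
    using val_less[of "binary_digits (nat \<bar>a\<bar>)"] by simp
  also have "\<dots> \<le> 2 ^ n" using assms by (intro power_increasing) (simp_all add: int_word_def)
  finally have "int (nat \<bar>a\<bar>) < int (2 ^ n)" by (simp only: of_nat_less_iff)
  then show ?thesis by simp
qed

lemma sharpP_mono: "S \<subseteq> T \<Longrightarrow> sharpP S \<subseteq> sharpP T"
  unfolding sharpP_def by blast

theorem theorem4: "sharpP {-1, 0, 1} = sharpP \<int>"
proof
  show "sharpP {-1, 0, 1} \<subseteq> sharpP \<int>" by (rule sharpP_mono) auto
  show "sharpP \<int> \<subseteq> sharpP {-1, 0, 1}"
  proof
    fix f assume "f \<in> sharpP \<int>"
    then obtain p w where f: "f = counting_fun p w" and wcp: "weighted_counting_problem p w"
      and w_Ints: "\<And>x u. w x u \<in> \<int>" by (auto simp: sharpP_def)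
    then obtain v where "polynomial_fun p" and "polytime_computable v"
      and approx: "\<And>x u b. \<bar>w x u - real_of_int (v x u b) / 2 ^ b\<bar> \<le> 1 / 2 ^ b"
      by (auto simp: weighted_counting_problem_def)
    then obtain N r where "wf_tm N" "polynomial_fun r" and comp: "\<And>x u b.
        tm_computes_within N [x, u, replicate b True] (int_word (v x u b)) (r (length x + length u + b))"
      by (auto simp: polytime_computable_def)
    define v2 where "v2 x u = v x u 2" for x u
    have comp2: "tm_computes_within N [x, u, [True, True]] (int_word (v2 x u)) (r (length x + length u + 2))"
      for x u using comp[of x u 2] by (simp add: v2_def numeral_2_eq_2)
    from this[of "[]" "[]"] have tapes: "tapes N > 3" by (simp add: tm_computes_within_def)
    obtain rq where rq: "\<And>n. real (r n) = poly rq (real n)"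
      using \<open>polynomial_fun r\<close> by (auto simp: polynomial_fun_def)
    \<comment> \<open>This \<open>K\<close> does double duty: it bounds the running time of
      \<open>N\<close>, and it is the number of nested loops and hence the exponent in the length of
      \<open>y\<close>.\<close>
    obtain K where K: "\<And>n :: nat. n \<ge> 2 \<Longrightarrow> poly rq (real n) \<le> real n ^ K"
      using polynomial_le_power[of rq] by blast
    have r: "r n \<le> n ^ K" if "n \<ge> 2" for n
      using K[OF that] unfolding rq[symmetric] by (simp flip: of_nat_power)
    obtain pq where pq: "\<And>n. real (p n) = poly pq (real n)"
      using \<open>polynomial_fun p\<close> by (auto simp: polynomial_fun_def)
    \<comment> \<open>This is the length of a code: two bits for each bit of \<open>u\<close>, the
      terminating 1, and \<open>y\<close>.\<close>
    define P where "P n = 2 * p n + 1 + (n + p n + 2) ^ K" for n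
    have "polynomial_fun P"
      unfolding polynomial_fun_def
      by (rule exI[of _ "2 * pq + 1 + ([:2, 1:] + pq) ^ K"]) (simp add: P_def pq algebra_simps)
    define W where "W x u = \<lfloor>w x u\<rfloor>" for x u
    have W: "w x u = real_of_int (W x u)" for x u
      using w_Ints[of x u] by (auto simp: W_def elim: Ints_cases)
    have near: "\<bar>4 * W x u - v2 x u\<bar> \<le> 1" for x u
    proof -
      have "\<bar>4 * w x u - real_of_int (v2 x u)\<bar> \<le> 1"
        using approx[of x u 2] by (simp add: v2_def abs_le_iff field_simps)
      then have "real_of_int \<bar>4 * W x u - v2 x u\<bar> \<le> real_of_int 1" by (simp add: W)
      then show ?thesis by (simp only: of_int_le_iff)
    qed
    \<comment> \<open>The output of \<open>N\<close> is no longer than its running time, which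
      bounds \<open>v2 x u\<close> by a power of two; \<open>near\<close> transfers the bound to
      \<open>W x u\<close>.\<close>
    have "\<bar>W x u\<bar> \<le> 2 ^ (length x + p (length x) + 2) ^ K" if u: "length u = p (length x)" for x u
    proof -
      obtain s ts where s: "s \<le> r (length x + length u + 2)"
        and run: "(tm_step N ^^ s) (initial_config N [x, u, [True, True]]) = (states N, ts)"
        and out: "reads_word (ts ! 3) (int_word (v2 x u))"
        using comp2[of x u] by (auto simp: tm_computes_within_def eval_nat_numeral)
      have "length (int_word (v2 x u)) \<le> s"
        using wf_tm_run[OF \<open>wf_tm N\<close> _ run] length_le_card_support[OF out] tapes
        by (auto simp: eval_nat_numeral intro: le_trans)
      also have "s \<le> (length x + p (length x) + 2) ^ K"
        using s r[of "length x + length u + 2"] u by simp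
      finally have "\<bar>v2 x u\<bar> < 2 ^ (length x + p (length x) + 2) ^ K" by (rule int_word_bound)
      with near[of x u] show ?thesis by linarith
    qed
    with near have sum: "(\<Sum>z | length z = P (length x). decide K v2 x z) = (\<Sum>u | length u = p (length x). W x u)"
      for x unfolding P_def by (intro sum_decide)
    let ?w = "\<lambda>x z. real_of_int (decide K v2 x z)"
    have "f = counting_fun P ?w"
    proof
      fix x
      show "f x = counting_fun P ?w x"
        using arg_cong[OF sum[of x], of real_of_int] by (simp add: f counting_fun_def W)
    qed
    moreover have "weighted_counting_problem P ?w"
      unfolding weighted_counting_problem_def
    proof (intro conjI exI allI)
      show "polytime_computable (\<lambda>x z b. 2 ^ b * decide K v2 x z)"
        using \<open>wf_tm N\<close> tapes comp2 r by (rule polytime_decide)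
    qed (use \<open>polynomial_fun P\<close> in simp_all)
    moreover have "?w x z \<in> {-1, 0, 1}" for x z
      by (auto simp: decide_def sgn_if split: option.splits)
    ultimately show "f \<in> sharpP {-1, 0, 1}" unfolding sharpP_def by blast
  qed
qed

end
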